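(* Let $E,F$ be Banach spaces such that there exists a quotient mapping $\rho:E\to F$. If $\mathcal P_w({}^nE,F)$ is an $M(1,C)$-ideal of $\mathcal P({}^nE,F)$ for some $n\in\mathbb N$ and some $C\in(0,1]$, then $F$ is an $M(1,C)$-ideal of $F^{**}$ (with the same $C$).
   Context: All Banach spaces are over $\mathbb K=\mathbb R$ or $\mathbb C$ (the same field for $E$ and $F$); $B_E$ is the closed unit ball, and $\mathbb N=\{1,2,\dots\}$. $\mathcal P({}^nE,F)$ is the Banach space of continuous $n$-homogeneous polynomials $P:E\to F$ with norm $\|P\|=\sup_{x\in B_E}\|P(x)\|$. $\mathcal P_w({}^nE,F)$ is the subspace of those polynomials that are weakly continuous on bounded sets, i.e. that map bounded weakly convergent nets to norm-convergent nets. A quotient mapping is a bounded linear operator mapping the open unit ball of the domain onto the open unit ball of the range (so its adjoint is an isometric embedding). For a closed subspace $J$ of a Banach space $X$, $J^\perp=\{x^*\in X^*: x^*(y)=0\ \forall y\in J\}$. $J$ is an ideal in $X$ if there is a norm-one linear projection $q$ on $X^*$ (i.e. $\|q\|\le1$) with $\ker q=J^\perp$. For $C\in(0,1]$, $J$ is an $M(1,C)$-ideal in $X$ if it is an ideal in $X$ with an associated projection $q$ satisfying $\|qf\|+C\|f-qf\|\le\|f\|$ for all $f\in X^*$. $F$ is regarded as a subspace of $F^{**}$ through the canonical embedding. *)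

theory Defs
  imports "HOL-Analysis.Analysis" "HOL-Library.Function_Algebras"
begin

section \<open>The scalar field\<close>

text \<open>
  A type of this class is isometrically isomorphic, as a field, to the real or to the complex
  numbers. It makes it possible to treat both cases by a single statement.
\<close>

class real_or_complex = real_normed_field +
  assumes isometric_real_or_complex:
    "\<exists>h :: 'a \<Rightarrow> complex.
       (\<forall>x y. h (x + y) = h x + h y) \<and> (\<forall>x y. h (x * y) = h x * h y) \<and>
       (\<forall>x. norm (h x) = norm x) \<and> (range h = \<real> \<or> range h = UNIV)"

instance real :: real_or_complex
proof
  show "\<exists>h :: real \<Rightarrow> complex.
       (\<forall>x y. h (x + y) = h x + h y) \<and> (\<forall>x y. h (x * y) = h x * h y) \<and>
       (\<forall>x. norm (h x) = norm x) \<and> (range h = \<real> \<or> range h = UNIV)"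
    by (rule exI[of _ complex_of_real]) (simp add: Reals_def)
qed

instance complex :: real_or_complex
proof
  show "\<exists>h :: complex \<Rightarrow> complex.
       (\<forall>x y. h (x + y) = h x + h y) \<and> (\<forall>x y. h (x * y) = h x * h y) \<and>
       (\<forall>x. norm (h x) = norm x) \<and> (range h = \<real> \<or> range h = UNIV)"
    by (rule exI[of _ "\<lambda>z. z"]) simp
qed

section \<open>Banach spaces and their duals\<close>

text \<open>
  A Banach space over \<open>'k\<close> is a type of class \<^class>\<open>banach\<close> (its underlying real Banach space)
  with a compatible multiplication by scalars of \<open>'k\<close>.
\<close>

locale banach_over = vector_space sV
  for sV :: "'k::real_or_complex \<Rightarrow> 'v::banach \<Rightarrow> 'v" +
  assumes norm_scale: "norm (sV c x) = norm c * norm x"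
    and scale_of_real: "sV (of_real r) x = r *\<^sub>R x"

text \<open>
  Spaces of functions (dual spaces, spaces of polynomials) are not types, so they are represented
  by a carrier set, a scalar multiplication and a norm; addition is that of the ambient type,
  which for function types is pointwise.
\<close>

record ('k, 'v) nspace =
  vecs :: "'v set"
  scl :: "'k \<Rightarrow> 'v \<Rightarrow> 'v"
  nrm :: "'v \<Rightarrow> real"

definition type_space ::
    "('k::real_or_complex \<Rightarrow> 'v::banach \<Rightarrow> 'v) \<Rightarrow> ('k, 'v) nspace" where
  "type_space sV = \<lparr>vecs = UNIV, scl = sV, nrm = norm\<rparr>"

text \<open>
  The topological dual. Functionals are set to \<open>0\<close> outside the carrier, so that each of them is
  represented by exactly one function.
\<close>

definition dual :: "('k::real_or_complex, 'v::ab_group_add) nspace \<Rightarrow> ('k, 'v \<Rightarrow> 'k) nspace" where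
  "dual X =
     \<lparr>vecs = {f. (\<forall>x\<in>vecs X. \<forall>y\<in>vecs X. f (x + y) = f x + f y) \<and>
                 (\<forall>c. \<forall>x\<in>vecs X. f (scl X c x) = c * f x) \<and>
                 (\<exists>B. \<forall>x\<in>vecs X. norm (f x) \<le> B * nrm X x) \<and>
                 (\<forall>x. x \<notin> vecs X \<longrightarrow> f x = 0)},
      scl = (\<lambda>c f x. c * f x),
      nrm = (\<lambda>f. SUP x\<in>{x \<in> vecs X. nrm X x \<le> 1}. norm (f x))\<rparr>"

definition canonical_embedding ::
    "('k::real_or_complex, 'v::ab_group_add) nspace \<Rightarrow> 'v \<Rightarrow> (('v \<Rightarrow> 'k) \<Rightarrow> 'k)" where
  "canonical_embedding X x = (\<lambda>f. if f \<in> vecs (dual X) then f x else 0)"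

definition quotient_mapping ::
    "('k::real_or_complex \<Rightarrow> 'e::banach \<Rightarrow> 'e) \<Rightarrow> ('k \<Rightarrow> 'f::banach \<Rightarrow> 'f) \<Rightarrow> ('e \<Rightarrow> 'f) \<Rightarrow> bool" where
  "quotient_mapping sE sF \<rho> \<longleftrightarrow>
     Vector_Spaces.linear sE sF \<rho> \<and> bounded_linear \<rho> \<and> \<rho> ` ball 0 1 = ball 0 1"

section \<open>Ideals\<close>

definition closed_subspace :: "('k::real_or_complex, 'v::ab_group_add) nspace \<Rightarrow> 'v set \<Rightarrow> bool" where
  "closed_subspace X J \<longleftrightarrow>
     J \<subseteq> vecs X \<and> 0 \<in> J \<and> (\<forall>x\<in>J. \<forall>y\<in>J. x + y \<in> J) \<and> (\<forall>c. \<forall>x\<in>J. scl X c x \<in> J) \<and>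
     (\<forall>x\<in>vecs X. (\<forall>e>0. \<exists>y\<in>J. nrm X (x - y) < e) \<longrightarrow> x \<in> J)"

definition annihilator ::
    "('k::real_or_complex, 'v::ab_group_add) nspace \<Rightarrow> 'v set \<Rightarrow> ('v \<Rightarrow> 'k) set" where
  "annihilator X J = {f \<in> vecs (dual X). \<forall>y\<in>J. f y = 0}"

definition ideal_projection ::
    "('k::real_or_complex, 'v::ab_group_add) nspace \<Rightarrow> 'v set \<Rightarrow> (('v \<Rightarrow> 'k) \<Rightarrow> ('v \<Rightarrow> 'k)) \<Rightarrow> bool" where
  "ideal_projection X J q \<longleftrightarrow>
     (\<forall>f\<in>vecs (dual X). q f \<in> vecs (dual X)) \<and>
     (\<forall>f\<in>vecs (dual X). \<forall>g\<in>vecs (dual X). q (f + g) = q f + q g) \<and>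
     (\<forall>c. \<forall>f\<in>vecs (dual X). q (scl (dual X) c f) = scl (dual X) c (q f)) \<and>
     (\<forall>f\<in>vecs (dual X). q (q f) = q f) \<and>
     (\<forall>f\<in>vecs (dual X). nrm (dual X) (q f) \<le> nrm (dual X) f) \<and>
     {f \<in> vecs (dual X). q f = 0} = annihilator X J"

definition M1_ideal ::
    "real \<Rightarrow> ('k::real_or_complex, 'v::ab_group_add) nspace \<Rightarrow> 'v set \<Rightarrow> bool" where
  "M1_ideal C X J \<longleftrightarrow>
     closed_subspace X J \<and>
     (\<exists>q. ideal_projection X J q \<and>
          (\<forall>f\<in>vecs (dual X).
             nrm (dual X) (q f) + C * nrm (dual X) (f - q f) \<le> nrm (dual X) f))"

section \<open>Homogeneous polynomials\<close>

text \<open>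
  An \<open>n\<close>-linear mapping is encoded as a function of a sequence of arguments
  which depends only on the entries with index less than \<open>n\<close>.
\<close>

definition n_linear ::
    "('k::real_or_complex \<Rightarrow> 'e::banach \<Rightarrow> 'e) \<Rightarrow> ('k \<Rightarrow> 'f::banach \<Rightarrow> 'f) \<Rightarrow> nat \<Rightarrow>
      ((nat \<Rightarrow> 'e) \<Rightarrow> 'f) \<Rightarrow> bool" where
  "n_linear sE sF n A \<longleftrightarrow>
     (\<forall>v. \<forall>i<n. Vector_Spaces.linear sE sF (\<lambda>x. A (v(i := x)))) \<and>
     (\<forall>v w. (\<forall>i<n. v i = w i) \<longrightarrow> A v = A w)"

definition homogeneous_polynomial ::
    "('k::real_or_complex \<Rightarrow> 'e::banach \<Rightarrow> 'e) \<Rightarrow> ('k \<Rightarrow> 'f::banach \<Rightarrow> 'f) \<Rightarrow> nat \<Rightarrow>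
      ('e \<Rightarrow> 'f) \<Rightarrow> bool" where
  "homogeneous_polynomial sE sF n P \<longleftrightarrow> (\<exists>A. n_linear sE sF n A \<and> (\<forall>x. P x = A (\<lambda>_. x)))"

definition poly_space ::
    "('k::real_or_complex \<Rightarrow> 'e::banach \<Rightarrow> 'e) \<Rightarrow> ('k \<Rightarrow> 'f::banach \<Rightarrow> 'f) \<Rightarrow> nat \<Rightarrow>
      ('k, 'e \<Rightarrow> 'f) nspace" where
  "poly_space sE sF n =
     \<lparr>vecs = {P. homogeneous_polynomial sE sF n P \<and> continuous_on UNIV P},
      scl = (\<lambda>c P x. sF c (P x)),
      nrm = (\<lambda>P. SUP x\<in>cball 0 1. norm (P x))\<rparr>"

text \<open>Convergence of the filter \<open>G\<close> to \<open>x\<close> in the weak topology.\<close>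

definition weakly_converges ::
    "('k::real_or_complex \<Rightarrow> 'e::banach \<Rightarrow> 'e) \<Rightarrow> 'e filter \<Rightarrow> 'e \<Rightarrow> bool" where
  "weakly_converges sE G x \<longleftrightarrow> (\<forall>f\<in>vecs (dual (type_space sE)). (f \<longlongrightarrow> f x) G)"

text \<open>
  Nets are replaced by filters. The two lemmas below show that this gives the usual notion.
\<close>

definition weakly_continuous_on_bounded ::
    "('k::real_or_complex \<Rightarrow> 'e::banach \<Rightarrow> 'e) \<Rightarrow> ('e \<Rightarrow> 'f::banach) \<Rightarrow> bool" where
  "weakly_continuous_on_bounded sE P \<longleftrightarrow>
     (\<forall>G. (\<exists>R. \<forall>\<^sub>F y in G. norm y \<le> R) \<and> (\<exists>x. weakly_converges sE G x) \<longrightarrow>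
          (\<exists>l. (P \<longlongrightarrow> l) G))"

definition wpoly_subspace ::
    "('k::real_or_complex \<Rightarrow> 'e::banach \<Rightarrow> 'e) \<Rightarrow> ('k \<Rightarrow> 'f::banach \<Rightarrow> 'f) \<Rightarrow> nat \<Rightarrow>
      ('e \<Rightarrow> 'f) set" where
  "wpoly_subspace sE sF n =
     {P \<in> vecs (poly_space sE sF n). weakly_continuous_on_bounded sE P}"

lemma weakly_continuous_on_bounded_net:
  fixes u :: "'i \<Rightarrow> 'e::banach" and G :: "'i filter"
  assumes "weakly_continuous_on_bounded sE P"
    and "\<forall>\<^sub>F i in G. norm (u i) \<le> R"
    and "\<And>f. f \<in> vecs (dual (type_space sE)) \<Longrightarrow> ((\<lambda>i. f (u i)) \<longlongrightarrow> f x) G"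
  shows "\<exists>l. ((\<lambda>i. P (u i)) \<longlongrightarrow> l) G"
proof -
  have "\<forall>\<^sub>F y in filtermap u G. norm y \<le> R"
    using assms(2) by (simp add: eventually_filtermap)
  moreover have "weakly_converges sE (filtermap u G) x"
    using assms(3) by (simp add: weakly_converges_def filterlim_filtermap)
  ultimately show ?thesis
    using assms(1) unfolding weakly_continuous_on_bounded_def
    by (metis filterlim_filtermap)
qed

definition weak_topology :: "('k::real_or_complex \<Rightarrow> 'e::banach \<Rightarrow> 'e) \<Rightarrow> 'e topology" where
  "weak_topology sE =
     topology_generated_by {f -` U |f U. f \<in> vecs (dual (type_space sE)) \<and> open U}"

lemma topspace_weak_topology [simp]: "topspace (weak_topology sE) = UNIV"
proof -
  have "(\<lambda>_. 0) \<in> vecs (dual (type_space sE))"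
    by (auto simp: dual_def type_space_def intro: exI[of _ 0])
  then have "UNIV \<in> {f -` U |f U. f \<in> vecs (dual (type_space sE)) \<and> open U}"
    by (intro CollectI exI[of _ "\<lambda>_. 0"] exI[of _ UNIV]) auto
  then show ?thesis
    unfolding weak_topology_def topology_generated_by_topspace by blast
qed

lemma weakly_converges_eventually:
  assumes "weakly_converges sE G x" "openin (weak_topology sE) W" "x \<in> W"
  shows "\<forall>\<^sub>F y in G. y \<in> W"
proof -
  have "generate_topology_on {f -` U |f U. f \<in> vecs (dual (type_space sE)) \<and> open U} W"
    using assms(2) by (simp add: weak_topology_def openin_topology_generated_by_iff)
  then show ?thesis using \<open>x \<in> W\<close>
  proof (induction rule: generate_topology_on.induct)
    case Empty
    then show ?case by simp
  next
    case (Int a b)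
    then show ?case by (simp add: eventually_conj)
  next
    case (UN K)
    then obtain k where "k \<in> K" "x \<in> k" by blast
    with UN.IH have "\<forall>\<^sub>F y in G. y \<in> k" by blast
    then show ?case by eventually_elim (use \<open>k \<in> K\<close> in blast)
  next
    case (Basis s)
    then obtain f U where s: "s = f -` U" "f \<in> vecs (dual (type_space sE))" "open U" by blast
    then have "(f \<longlongrightarrow> f x) G" using assms(1) by (simp add: weakly_converges_def)
    then show ?case using s Basis.prems by (auto dest: topological_tendstoD)
  qed
qed

lemma weakly_continuous_on_bounded_iff_continuous_map:
  "weakly_continuous_on_bounded sE P \<longleftrightarrow>
     (\<forall>B. bounded B \<longrightarrow> continuous_map (subtopology (weak_topology sE) B) euclidean P)"
proof
  assume P: "weakly_continuous_on_bounded sE P"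
  show "\<forall>B. bounded B \<longrightarrow> continuous_map (subtopology (weak_topology sE) B) euclidean P"
  proof (intro allI impI)
    fix B :: "'b set" assume "bounded B"
    then obtain R where R: "\<And>y. y \<in> B \<Longrightarrow> norm y \<le> R" by (auto simp: bounded_iff)
    show "continuous_map (subtopology (weak_topology sE) B) euclidean P"
      unfolding continuous_map_atin
    proof
      fix x assume "x \<in> topspace (subtopology (weak_topology sE) B)"
      then have xB: "x \<in> B" by simp
      let ?T = "subtopology (weak_topology sE) B"
      let ?G = "sup (atin ?T x) (principal {x})"
      have eva: "\<forall>\<^sub>F y in atin ?T x. y \<in> W \<and> y \<in> B"
        if W: "openin (weak_topology sE) W" "x \<in> W" for W
      proof -
        have "openin ?T (W \<inter> B)" using W(1) by (auto simp: openin_subtopology)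
        moreover have "x \<in> W \<inter> B" using W(2) xB by blast
        ultimately show ?thesis unfolding eventually_atin by blast
      qed
      have "\<forall>\<^sub>F y in atin ?T x. y \<in> B"
        using eva[of UNIV] openin_topspace[of "weak_topology sE"] by simp
      then have "\<forall>\<^sub>F y in ?G. norm y \<le> R"
        unfolding eventually_sup eventually_principal
        using R xB by (auto intro: eventually_mono[of "\<lambda>y. y \<in> B"])
      moreover have "weakly_converges sE ?G x"
        unfolding weakly_converges_def
      proof (intro ballI topological_tendstoI)
        fix f :: "'b \<Rightarrow> 'a" and U
        assume f: "f \<in> vecs (dual (type_space sE))" "open U" "f x \<in> U"
        have "openin (weak_topology sE) (f -` U)"
          unfolding weak_topology_def using f by (intro topology_generated_by_Basis) blast
        from eva[OF this] f(3) have "\<forall>\<^sub>F y in atin ?T x. f y \<in> U"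
          by (auto intro: eventually_mono[of "\<lambda>y. y \<in> f -` U \<and> y \<in> B"])
        then show "\<forall>\<^sub>F y in ?G. f y \<in> U"
          using f(3) by (simp add: eventually_sup eventually_principal)
      qed
      ultimately obtain l where "(P \<longlongrightarrow> l) ?G"
        using P unfolding weakly_continuous_on_bounded_def by blast
      then have l: "(P \<longlongrightarrow> l) (atin ?T x)" "(P \<longlongrightarrow> l) (principal {x})"
        unfolding filterlim_def filtermap_sup by auto
      have "(P \<longlongrightarrow> P x) (principal {x})"
        by (rule tendsto_eventually) (simp add: eventually_principal)
      with l(2) have "l = P x"
        by (intro tendsto_unique[of "principal {x}" P]) (auto simp: principal_eq_bot_iff)
      with l(1) show "limitin euclidean P (P x) (atin ?T x)" by simp
    qed
  qed
next
  assume P: "\<forall>B. bounded B \<longrightarrow> continuous_map (subtopology (weak_topology sE) B) euclidean P"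
  show "weakly_continuous_on_bounded sE P"
    unfolding weakly_continuous_on_bounded_def
  proof (intro allI impI, elim conjE exE)
    fix G R x assume G: "\<forall>\<^sub>F y in G. norm y \<le> R" "weakly_converges sE G x"
    let ?B = "insert x (cball 0 R)"
    have cont: "continuous_map (subtopology (weak_topology sE) ?B) euclidean P"
      using P by simp
    have "(P \<longlongrightarrow> P x) G"
    proof (rule topological_tendstoI)
      fix U assume U: "open U" "P x \<in> U"
      have "openin (subtopology (weak_topology sE) ?B) {y \<in> ?B. P y \<in> U}"
        using openin_continuous_map_preimage[OF cont, of U] U by simp
      then obtain W where W: "openin (weak_topology sE) W" "{y \<in> ?B. P y \<in> U} = W \<inter> ?B"
        by (auto simp: openin_subtopology)
      then have "x \<in> W" using U by blast
      with G(2) W(1) have "\<forall>\<^sub>F y in G. y \<in> W" by (rule weakly_converges_eventually)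
      moreover have "P y \<in> U" if "norm y \<le> R" "y \<in> W" for y
      proof -
        have "y \<in> W \<inter> ?B" using that by simp
        then have "y \<in> {y \<in> ?B. P y \<in> U}" by (simp only: W(2))
        then show ?thesis by blast
      qed
      ultimately show "\<forall>\<^sub>F y in G. P y \<in> U"
        using G(1) by (auto elim: eventually_elim2)
    qed
    then show "\<exists>l. (P \<longlongrightarrow> l) G" by blast
  qed
qed

end

theory Submission
  imports Defs
begin

text \<open>
  Let \<open>J\<close> be the canonical embedding of \<open>F\<close> into \<open>F**\<close>. The projection on \<open>F***\<close> which makes \<open>F\<close>
  an ideal in \<open>F**\<close> is the canonical one, \<open>(\<pi> \<psi>) z = z (\<psi> \<circ> J)\<close>, and the inequality to be proved is
  \<open>\<parallel>\<psi> \<circ> J\<parallel> + C * \<bar>\<psi> z - (\<pi> \<psi>) z\<bar> \<le> \<parallel>\<psi>\<parallel>\<close> for each \<open>z\<close> of norm \<open>1\<close>. It is obtained from the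
  inequality for polynomials by evaluating polynomials at \<open>z\<close>.

  By Goldstine's theorem \<open>z\<close> is a weak* limit of points of the open unit ball of \<open>F\<close>, and these are
  images under \<open>\<rho>\<close> of points of the open unit ball of \<open>E\<close>. Hence there is a filter on that ball along
  which \<open>\<rho> x\<close> tends weak* to \<open>z\<close>, and by compactness it can be refined until all bounded scalar
  functions converge (\<open>bidual_limit_exists\<close>). The weak* limit of \<open>P x\<close> along this filter is a point
  \<open>limit_value P\<close> of \<open>F**\<close>, linear in \<open>P\<close> and of norm at most \<open>\<parallel>P\<parallel>\<close>, so that
  \<open>\<Phi> P = \<psi> (limit_value P)\<close> and \<open>\<Phi>0 P = (\<pi> \<psi>) (limit_value P)\<close> are functionals of norms at most
  \<open>\<parallel>\<psi>\<parallel>\<close> and \<open>\<parallel>\<psi> \<circ> J\<parallel>\<close>.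

  If \<open>P\<close> is weakly continuous on bounded sets, then \<open>P x\<close> even converges in norm
  (\<open>weakly_Cauchy_imp_convergent\<close>), so that \<open>limit_value P\<close> lies in \<open>F\<close>, where \<open>\<psi>\<close> and \<open>\<pi> \<psi>\<close> agree.
  Therefore \<open>\<Phi> - \<Phi>0\<close> annihilates these polynomials, and the given projection \<open>q\<close> satisfies
  \<open>q \<Phi> = q \<Phi>0\<close>. Testing with \<open>x \<mapsto> g (\<rho> x) ^ n \<cdot> y\<close>, where \<open>\<bar>z g\<bar>\<close> is close to \<open>1\<close>, shows that the
  restriction of \<open>\<Phi>0\<close> to these polynomials already has norm \<open>\<parallel>\<psi> \<circ> J\<parallel>\<close>; so \<open>\<Phi>0\<close> is a norm-preserving
  extension of its restriction, and the inequality for \<open>q\<close> forces \<open>q \<Phi>0 = \<Phi>0\<close>. The inequality for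
  \<open>\<Phi>\<close> now reads \<open>\<parallel>\<Phi>0\<parallel> + C * \<parallel>\<Phi> - \<Phi>0\<parallel> \<le> \<parallel>\<psi>\<parallel>\<close>, and testing \<open>\<Phi> - \<Phi>0\<close> with
  \<open>x \<mapsto> g (\<rho> x) ^ (n - 1) \<cdot> \<rho> x\<close>, whose value at \<open>z\<close> is almost \<open>z\<close> up to a unimodular factor, gives
  the claim (\<open>M1_inequality_at_unit_vector\<close>).

  The Hahn-Banach theorem enters only through the isometry of \<open>J\<close>, which makes its range closed.
\<close>

section \<open>Scalars\<close>

text \<open>
  The class of scalar fields only asserts that an isometric embedding into the complex numbers
  exists. Fixing one gives access to real parts.
\<close>

definition scalar_embedding :: "'k::real_or_complex \<Rightarrow> complex" where
  "scalar_embedding = (SOME h. (\<forall>x y. h (x + y) = h x + h y) \<and> (\<forall>x y. h (x * y) = h x * h y) \<and>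
       (\<forall>x. norm (h x) = norm x) \<and> (range h = \<real> \<or> range h = UNIV))"

lemma scalar_embedding:
  fixes x y :: "'k::real_or_complex"
  shows scalar_embedding_add: "scalar_embedding (x + y) = scalar_embedding x + scalar_embedding y"
    and scalar_embedding_mult: "scalar_embedding (x * y) = scalar_embedding x * scalar_embedding y"
    and norm_scalar_embedding: "norm (scalar_embedding x) = norm x"
    and range_scalar_embedding: "range (scalar_embedding :: 'k \<Rightarrow> _) = \<real> \<or>
      range (scalar_embedding :: 'k \<Rightarrow> _) = UNIV"
  using someI_ex[OF isometric_real_or_complex[where 'a = 'k]]
  unfolding scalar_embedding_def[symmetric] by auto

lemma scalar_embedding_diff:
  "scalar_embedding (x - y) = scalar_embedding x - scalar_embedding (y :: 'k::real_or_complex)"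
  using scalar_embedding_add[of "x - y" y] by simp

lemma dist_scalar_embedding:
  "dist (scalar_embedding x) (scalar_embedding (y :: 'k::real_or_complex)) = dist x y"
  by (simp add: dist_norm norm_scalar_embedding flip: scalar_embedding_diff)

lemma scalar_embedding_eq_iff:
  "scalar_embedding x = scalar_embedding y \<longleftrightarrow> x = (y :: 'k::real_or_complex)"
  using dist_scalar_embedding[of x y] by (metis dist_eq_0_iff)

text \<open>
  Isometry alone determines the image of a real scalar: the image of \<open>r\<close> has distance \<open>\<bar>r\<bar>\<close> from \<open>0\<close> and distance
  \<open>\<bar>r - 1\<bar>\<close> from \<open>1\<close>, and the two circles meet only in \<open>r\<close>.
\<close>

lemma scalar_embedding_of_real: "scalar_embedding (of_real r :: 'k::real_or_complex) = of_real r"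
proof -
  let ?h = "scalar_embedding :: 'k \<Rightarrow> complex"
  have "?h 1 * ?h 1 = ?h 1" by (metis mult_1 scalar_embedding_mult)
  moreover have "?h 1 \<noteq> 0" using norm_scalar_embedding[of "1::'k"] by auto
  ultimately have one: "?h 1 = 1" by simp
  let ?z = "?h (of_real r)"
  have "norm ?z = \<bar>r\<bar>" by (simp add: norm_scalar_embedding)
  then have 1: "(Re ?z)\<^sup>2 + (Im ?z)\<^sup>2 = r\<^sup>2"
    by (metis cmod_power2 power2_abs)
  have "norm (?z - 1) = norm (of_real (r - 1) :: 'k)"
    by (simp only: of_real_diff of_real_1 one[symmetric] scalar_embedding_diff[symmetric] norm_scalar_embedding)
  then have "norm (?z - 1) = \<bar>r - 1\<bar>" by (simp only: norm_of_real)
  then have 2: "(Re ?z - 1)\<^sup>2 + (Im ?z)\<^sup>2 = (r - 1)\<^sup>2"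
    by (metis cmod_power2 power2_abs minus_complex.simps one_complex.simps diff_zero)
  from 1 2 have "Re ?z = r" by (simp add: power2_eq_square algebra_simps)
  with 1 have "?z = Complex r 0" by (simp add: complex_eq_iff)
  then show ?thesis by (simp add: complex_of_real_def)
qed

definition re :: "'k::real_or_complex \<Rightarrow> real" where
  "re x = Re (scalar_embedding x)"

lemma re_add: "re (x + y) = re x + re y"
  by (simp add: re_def scalar_embedding_add)

lemma re_diff: "re (x - y) = re x - re y"
  by (simp add: re_def scalar_embedding_diff)

lemma re_of_real [simp]: "re (of_real r) = r"
  by (simp add: re_def scalar_embedding_of_real)

lemma re_of_real_mult: "re (of_real r * x) = r * re x"
  by (simp add: re_def scalar_embedding_of_real scalar_embedding_mult)

lemma re_0 [simp]: "re 0 = 0"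
  using re_of_real[of 0] by simp

lemma abs_re_le: "\<bar>re x\<bar> \<le> norm x"
  unfolding re_def by (metis abs_Re_le_cmod norm_scalar_embedding)

lemma re_sum: "re (sum f A) = (\<Sum>a\<in>A. re (f a))"
  by (induction A rule: infinite_finite_induct) (auto simp: re_add)

text \<open>
  In the real case \<open>0\<close> plays the part of the imaginary unit, so that one formula reconstructs a
  scalar from real parts in both cases.
\<close>

lemma imaginary_unit:
  obtains \<iota> :: "'k::real_or_complex"
  where "\<iota> = 0 \<or> \<iota> * \<iota> = -1" and "norm \<iota> \<le> 1" and "\<And>c. c = of_real (re c) - of_real (re (\<iota> * c)) * \<iota>"
proof (cases "range (scalar_embedding :: 'k \<Rightarrow> _) = \<real>")
  case True
  show ?thesis
  proof (rule that[of 0])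
    fix c :: 'k
    obtain r where "scalar_embedding c = of_real r" using True by (auto simp: Reals_def)
    then have "c = of_real r"
      by (metis scalar_embedding_of_real scalar_embedding_eq_iff)
    then show "c = of_real (re c) - of_real (re (0 * c)) * 0" by simp
  qed auto
next
  case False
  then have "range (scalar_embedding :: 'k \<Rightarrow> _) = UNIV" using range_scalar_embedding by blast
  then obtain \<iota> :: 'k where i: "scalar_embedding \<iota> = \<i>" by (metis UNIV_I imageE)
  show ?thesis
  proof (rule that)
    have "scalar_embedding (\<iota> * \<iota>) = scalar_embedding (of_real (-1) :: 'k)"
      by (simp only: scalar_embedding_mult i scalar_embedding_of_real) simp
    then have "\<iota> * \<iota> = of_real (-1)" by (simp only: scalar_embedding_eq_iff)
    then show "\<iota> = 0 \<or> \<iota> * \<iota> = -1" by simp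
    show "norm \<iota> \<le> 1" using norm_scalar_embedding[of \<iota>] i by simp
    fix c
    have "scalar_embedding c = scalar_embedding (of_real (re c) - of_real (re (\<iota> * c)) * \<iota>)"
      by (simp only: complex_eq_iff re_def scalar_embedding_mult scalar_embedding_diff i scalar_embedding_of_real)
        simp
    then show "c = of_real (re c) - of_real (re (\<iota> * c)) * \<iota>"
      by (simp only: scalar_embedding_eq_iff)
  qed
qed

text \<open>
  The scalars form an isometric copy of a closed subset of the plane.
\<close>

lemma compact_cball_scalar: "compact (cball 0 R :: 'k::real_or_complex set)"
proof -
  let ?h = "scalar_embedding :: 'k \<Rightarrow> complex"
  have "closed (range ?h)" using range_scalar_embedding closed_complex_Reals by (metis closed_UNIV)
  then have "compact (cball 0 R \<inter> range ?h)" by (simp add: compact_Int_closed)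
  moreover have "continuous_on (cball 0 R \<inter> range ?h) (inv ?h)"
  proof (rule continuous_onI)
    fix w e assume "w \<in> cball 0 R \<inter> range ?h" "(e::real) > 0"
    moreover have "inj ?h" by (simp add: inj_def scalar_embedding_eq_iff)
    ultimately show "\<exists>d>0. \<forall>x'\<in>cball 0 R \<inter> range ?h. dist x' w < d \<longrightarrow> dist (inv ?h x') (inv ?h w) \<le> e"
      by (intro exI[of _ e]) (auto simp: dist_scalar_embedding)
  qed
  moreover have "inv ?h ` (cball 0 R \<inter> range ?h) = cball 0 R"
  proof -
    have "inj ?h" by (simp add: inj_def scalar_embedding_eq_iff)
    moreover have "cball 0 R \<inter> range ?h = ?h ` cball 0 R"
      by (auto simp: norm_scalar_embedding)
    ultimately show ?thesis by (simp add: image_image)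
  qed
  ultimately show ?thesis by (metis compact_continuous_image)
qed

section \<open>Generalised limits\<close>

text \<open>
  The subfilter serves as an ultrafilter. It comes from Tychonoff's theorem: sending \<open>x\<close> to the family
  of all its values \<open>k x\<close> maps \<open>G\<close> into a product of compact balls, and the image of \<open>G\<close> has a cluster
  point \<open>p\<close>. On the trace of the neighbourhoods of \<open>p\<close> all coordinates converge simultaneously.
\<close>

lemma convergent_subfilter:
  fixes G :: "'a filter"
  assumes "G \<noteq> bot"
  obtains G' where "G' \<noteq> bot" "G' \<le> G"
    "\<And>k :: 'a \<Rightarrow> 'k::real_or_complex. (\<exists>R. \<forall>\<^sub>F x in G. norm (k x) \<le> R) \<Longrightarrow> \<exists>l. (k \<longlongrightarrow> l) G'"
proof -
  define R where "R k = (SOME R. \<forall>\<^sub>F x in G. norm (k x) \<le> R)" for k :: "'a \<Rightarrow> 'k"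
  \<comment> \<open>A bound for \<open>k\<close> holds only eventually; cutting off there puts every point into the product.\<close>
  define \<Psi> :: "'a \<Rightarrow> ('a \<Rightarrow> 'k) \<Rightarrow> 'k"
    where "\<Psi> x k = (if norm (k x) \<le> R k then k x else 0)" for x k
  define K where "K = PiE UNIV (\<lambda>k. cball 0 \<bar>R k\<bar> :: 'k set)"
  have "compactin (product_topology (\<lambda>i. euclidean) UNIV) K"
    unfolding K_def compactin_PiE by (simp add: compact_cball_scalar compactin_euclidean_iff)
  then have "compact K" by (simp add: euclidean_product_topology)
  moreover have "filtermap \<Psi> G \<noteq> bot" using assms by (simp add: filtermap_bot_iff)
  moreover have "eventually (\<lambda>\<psi>. \<psi> \<in> K) (filtermap \<Psi> G)"
    unfolding eventually_filtermap by (rule always_eventually) (auto simp: K_def \<Psi>_def)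
  ultimately obtain p where p: "inf (nhds p) (filtermap \<Psi> G) \<noteq> bot"
    unfolding compact_filter by blast
  define G' where "G' = inf G (filtercomap \<Psi> (nhds p))"
  show ?thesis
  proof (rule that)
    show "G' \<noteq> bot"
    proof
      assume "G' = bot"
      then obtain Q Q' where "eventually Q G" "eventually Q' (nhds p)" and Q: "\<And>x. Q x \<and> Q' (\<Psi> x) \<Longrightarrow> False"
        unfolding G'_def trivial_limit_def eventually_inf eventually_filtercomap by blast
      then have Q': "eventually Q' (nhds p)" "\<forall>\<^sub>F x in G. \<not> Q' (\<Psi> x)"
        using eventually_mono[OF \<open>eventually Q G\<close>, of "\<lambda>x. \<not> Q' (\<Psi> x)"] Q by blast+
      have "eventually (\<lambda>_. False) (inf (nhds p) (filtermap \<Psi> G))"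
        unfolding eventually_inf eventually_filtermap
      proof (intro exI conjI)
        show "\<forall>\<psi>. Q' \<psi> \<and> \<not> Q' \<psi> \<longrightarrow> False" by blast
      qed (use Q' in auto)
      with p show False by (simp add: trivial_limit_def)
    qed
    show "G' \<le> G" by (simp add: G'_def)
    fix k :: "'a \<Rightarrow> 'k" assume k: "\<exists>R. \<forall>\<^sub>F x in G. norm (k x) \<le> R"
    have "filterlim \<Psi> (nhds p) (filtercomap \<Psi> (nhds p))" by (rule filterlim_filtercomap)
    then have "filterlim \<Psi> (nhds p) G'"
      by (rule filterlim_mono) (auto simp: G'_def)
    then have lim: "((\<lambda>x. \<Psi> x k) \<longlongrightarrow> p k) G'"
      using continuous_on_tendsto_compose[OF continuous_on_product_coordinates[of k]] by simp
    have "\<forall>\<^sub>F x in G. norm (k x) \<le> R k"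
      unfolding R_def by (rule someI_ex[OF k])
    then have "\<forall>\<^sub>F x in G. \<Psi> x k = k x"
      by eventually_elim (simp add: \<Psi>_def)
    then have "\<forall>\<^sub>F x in G'. \<Psi> x k = k x"
      by (rule filter_leD[OF \<open>G' \<le> G\<close>])
    then have "(k \<longlongrightarrow> p k) G'"
      by (rule Lim_transform_eventually[OF lim])
    then show "\<exists>l. (k \<longlongrightarrow> l) G'" ..
  qed
qed


section \<open>Norming functionals\<close>

definition sublinear :: "('v::real_vector \<Rightarrow> real) \<Rightarrow> bool" where
  "sublinear p \<longleftrightarrow> (\<forall>x y. p (x + y) \<le> p x + p y) \<and> (\<forall>t\<ge>0. \<forall>x. p (t *\<^sub>R x) \<le> t * p x)"

lemma sublinear_add: "sublinear p \<Longrightarrow> p (x + y) \<le> p x + p y"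
  by (simp add: sublinear_def)

text \<open>
  The inequality in the definition, applied to the factor \<open>1 / t\<close>, yields the reverse one.
\<close>

lemma sublinear_scaleR:
  assumes "sublinear p" "t \<ge> 0"
  shows "p (t *\<^sub>R x) = t * p x"
proof (cases "t = 0")
  case True
  have "p 0 \<le> 0" using assms(1) unfolding sublinear_def
    by (metis mult_zero_left order_refl scaleR_zero_left)
  moreover have "p 0 \<ge> 0" using sublinear_add[OF assms(1), of 0 0] by simp
  ultimately show ?thesis using True by simp
next
  case False
  then have t: "t > 0" using assms by simp
  have "p ((1/t) *\<^sub>R (t *\<^sub>R x)) \<le> (1/t) * p (t *\<^sub>R x)"
    using assms(1) t unfolding sublinear_def by (meson less_imp_le zero_less_divide_1_iff)
  then have "t * p x \<le> p (t *\<^sub>R x)" using t by (simp add: field_simps)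
  moreover have "p (t *\<^sub>R x) \<le> t * p x" using assms by (simp add: sublinear_def)
  ultimately show ?thesis by simp
qed

lemma sublinear_0: "sublinear p \<Longrightarrow> p 0 = 0"
  using sublinear_scaleR[of p 0 0] by simp

lemma sublinear_neg: "sublinear p \<Longrightarrow> - p (- x) \<le> p x"
  using sublinear_add[of p x "- x"] sublinear_0[of p] by simp

text \<open>
  The functional \<open>x \<mapsto> inf (p (x + t y) - t p y)\<close>, over \<open>t \<ge> 0\<close>, lies below \<open>p\<close> and takes a value at most
  \<open>- p y\<close> at \<open>- y\<close>. So a sublinear functional that is not odd can be replaced by a smaller one.
\<close>

lemma sublinear_lower:
  assumes "sublinear p"
  obtains q where "sublinear q" "q \<le> p" "q (- y) \<le> - p y"
proof -
  define q where "q x = (INF t\<in>{0..}. p (x + t *\<^sub>R y) - t * p y)" for x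
  have bdd: "bdd_below ((\<lambda>t. p (x + t *\<^sub>R y) - t * p y) ` {0..})" for x
  proof (rule bdd_belowI2)
    fix t :: real assume "t \<in> {0..}"
    then have "p (t *\<^sub>R y) = t * p y" using sublinear_scaleR[OF assms] by simp
    moreover have "p (t *\<^sub>R y) \<le> p (x + t *\<^sub>R y) + p (- x)"
      using sublinear_add[OF assms, of "x + t *\<^sub>R y" "- x"] by simp
    ultimately show "- p (- x) \<le> p (x + t *\<^sub>R y) - t * p y" by simp
  qed
  have le: "q x \<le> p (x + t *\<^sub>R y) - t * p y" if "t \<ge> 0" for x t
    unfolding q_def using that by (intro cINF_lower bdd) auto
  show ?thesis
  proof (rule that)
    show "sublinear q" unfolding sublinear_def
    proof (intro conjI allI impI)
      fix x x'
      have "q (x + x') - (p (x' + s *\<^sub>R y) - s * p y) \<le> q x" if "s \<ge> 0" for s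
        unfolding q_def[of x]
      proof (rule cINF_greatest)
        fix t :: real assume "t \<in> {0..}"
        then have "q (x + x') \<le> p ((x + x') + (t + s) *\<^sub>R y) - (t + s) * p y" using that by (intro le) auto
        also have "p ((x + x') + (t + s) *\<^sub>R y) \<le> p (x + t *\<^sub>R y) + p (x' + s *\<^sub>R y)"
          using sublinear_add[OF assms, of "x + t *\<^sub>R y" "x' + s *\<^sub>R y"] by (simp add: algebra_simps)
        finally show "q (x + x') - (p (x' + s *\<^sub>R y) - s * p y) \<le> p (x + t *\<^sub>R y) - t * p y"
          by (simp add: algebra_simps)
      qed auto
      then have "q (x + x') - q x \<le> q x'"
        unfolding q_def[of x'] by (intro cINF_greatest) (auto simp: algebra_simps)
      then show "q (x + x') \<le> q x + q x'" by simp
    next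
      fix s :: real and x assume s: "s \<ge> 0"
      show "q (s *\<^sub>R x) \<le> s * q x"
      proof (cases "s = 0")
        case True
        then show ?thesis using le[of 0 0] sublinear_0[OF assms] by simp
      next
        case False
        have "q (s *\<^sub>R x) / s \<le> q x" unfolding q_def[of x]
        proof (rule cINF_greatest)
          fix t :: real assume "t \<in> {0..}"
          then have "q (s *\<^sub>R x) \<le> p (s *\<^sub>R x + (s * t) *\<^sub>R y) - (s * t) * p y"
            using s by (intro le) auto
          also have "\<dots> = s * (p (x + t *\<^sub>R y) - t * p y)"
            using sublinear_scaleR[OF assms s, of "x + t *\<^sub>R y"] by (simp add: algebra_simps)
          finally show "q (s *\<^sub>R x) / s \<le> p (x + t *\<^sub>R y) - t * p y"
            using s False by (simp add: field_simps)
        qed auto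
        then show ?thesis using s False by (simp add: field_simps)
      qed
    qed
    show "q \<le> p" using le[of 0] by (auto simp: le_fun_def)
    show "q (- y) \<le> - p y" using le[of 1 "- y"] sublinear_0[OF assms] by simp
  qed
qed

text \<open>
  A minimal sublinear functional below \<open>p\<close> exists by Zorn's lemma, since the values \<open>q x\<close> of all the
  candidates are bounded below by \<open>- p (- x)\<close> and a chain therefore has an infimum. By
  \<open>sublinear_lower\<close> a minimal functional is odd; being subadditive and odd, it is linear.
\<close>

lemma Hahn_Banach:
  fixes p :: "'v::real_vector \<Rightarrow> real"
  assumes "sublinear p"
  obtains u where "linear u" "u \<le> p"
proof -
  define S where "S = {q. sublinear q \<and> q \<le> p}"
  have "\<exists>m\<in>S. \<forall>a\<in>S. (\<lambda>p q. q \<le> p) m a \<longrightarrow> a = m"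
  proof (rule predicate_Zorn)
    show "partial_order_on S (relation_of (\<lambda>p q. q \<le> p) S)"
      by (rule partial_order_on_relation_ofI) auto
  next
    fix \<C> assume "\<C> \<in> Chains (relation_of (\<lambda>p q. q \<le> p) S)"
    then have \<C>: "\<C> \<subseteq> S" "\<And>q r. q \<in> \<C> \<Longrightarrow> r \<in> \<C> \<Longrightarrow> q \<le> r \<or> r \<le> q"
      unfolding Chains_def relation_of_def by blast+
    show "\<exists>u\<in>S. \<forall>a\<in>\<C>. u \<le> a"
    proof (cases "\<C> = {}")
      case True
      then show ?thesis using assms by (auto simp: S_def)
    next
      case False
      define u where "u x = (INF q\<in>\<C>. q x)" for x
      have bdd: "bdd_below ((\<lambda>q. q x) ` \<C>)" for x
      proof (rule bdd_belowI2)
        fix q assume "q \<in> \<C>"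
        then have "sublinear q" "q (- x) \<le> p (- x)" using \<C> by (auto simp: S_def le_fun_def)
        then show "- p (- x) \<le> q x" using sublinear_neg[of q x] by simp
      qed
      have le: "u x \<le> q x" if "q \<in> \<C>" for x q
        unfolding u_def using that by (intro cINF_lower bdd)
      have "sublinear u" unfolding sublinear_def
      proof (intro conjI allI impI)
        fix x y
        have *: "u (x + y) \<le> q x + r y" if "q \<in> \<C>" "r \<in> \<C>" for q r
        proof -
          obtain s where s: "s \<in> \<C>" "s \<le> q" "s \<le> r" using \<C>(2)[of q r] \<open>q \<in> \<C>\<close> \<open>r \<in> \<C>\<close> by blast
          then have "s (x + y) \<le> s x + s y" using \<C>(1) sublinear_add by (auto simp: S_def)
          then show ?thesis using le[OF s(1), of "x + y"] s(2,3)
            by (smt (verit) le_funD)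
        qed
        have "u (x + y) - r y \<le> u x" if "r \<in> \<C>" for r
          unfolding u_def[of x] using False *[OF _ that] by (intro cINF_greatest) (auto simp: algebra_simps)
        then have "u (x + y) - u x \<le> u y"
          unfolding u_def[of y] using False by (intro cINF_greatest) (auto simp: algebra_simps)
        then show "u (x + y) \<le> u x + u y" by simp
      next
        fix t :: real and x assume t: "t \<ge> 0"
        show "u (t *\<^sub>R x) \<le> t * u x"
        proof (cases "t = 0")
          case True
          obtain q where "q \<in> \<C>" using False by blast
          then show ?thesis using le[of q 0] \<C>(1) True by (auto simp: S_def sublinear_0)
        next
          case nz: False
          have "u (t *\<^sub>R x) / t \<le> u x" unfolding u_def[of x]
          proof (rule cINF_greatest[OF False])
            fix q assume q: "q \<in> \<C>"
            then have "u (t *\<^sub>R x) \<le> t * q x"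
              using le[of q "t *\<^sub>R x"] sublinear_scaleR[of q t x] t \<C>(1) by (auto simp: S_def)
            then show "u (t *\<^sub>R x) / t \<le> q x" using t nz by (simp add: field_simps)
          qed
          then show ?thesis using t nz by (simp add: field_simps)
        qed
      qed
      moreover have "u \<le> p"
        using False \<C>(1) le unfolding S_def le_fun_def
        by (metis (mono_tags, lifting) all_not_in_conv mem_Collect_eq order.trans subsetD)
      ultimately show ?thesis using le by (auto simp: S_def le_fun_def)
    qed
  qed
  then obtain m where m: "sublinear m" "m \<le> p"
    and min: "\<And>q. sublinear q \<Longrightarrow> q \<le> m \<Longrightarrow> q = m"
    unfolding S_def by (smt (verit, del_insts) mem_Collect_eq order_trans)
  have neg: "m (- y) = - m y" for y
  proof -
    obtain q where "sublinear q" "q \<le> m" "q (- y) \<le> - m y" using sublinear_lower[OF m(1)] .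
    then show ?thesis using min sublinear_neg[OF m(1), of y] by fastforce
  qed
  show ?thesis
  proof
    show "linear m"
    proof (rule linearI)
      fix x y
      show "m (x + y) = m x + m y"
        using sublinear_add[OF m(1), of x y] sublinear_add[OF m(1), of "- x" "- y"] neg[of "x + y"] by (simp add: neg)
      fix t :: real
      show "m (t *\<^sub>R x) = t *\<^sub>R m x"
      proof (cases "t \<ge> 0")
        case True
        then show ?thesis by (simp add: sublinear_scaleR[OF m(1)])
      next
        case False
        then have "m ((- t) *\<^sub>R x) = (- t) * m x" by (intro sublinear_scaleR[OF m(1)]) auto
        then show ?thesis by (simp add: neg)
      qed
    qed
  qed (fact m(2))
qed

text \<open>
  The norm is first lowered in the direction of \<open>y\<close>; every linear functional below the result takes
  the value \<open>norm y\<close> at \<open>y\<close>.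
\<close>

lemma real_norming_functional:
  fixes y :: "'v::real_normed_vector"
  obtains u where "linear u" "\<And>x. u x \<le> norm x" "u y = norm y"
proof -
  have "sublinear (norm :: 'v \<Rightarrow> real)"
    by (simp add: sublinear_def norm_triangle_ineq)
  then obtain q :: "'v \<Rightarrow> real" where q: "sublinear q" "q \<le> norm" "q (- y) \<le> - norm y"
    by (rule sublinear_lower)
  obtain u where u: "linear u" "u \<le> q" using Hahn_Banach[OF q(1)] .
  have le: "u x \<le> norm x" for x using u(2) q(2) by (auto simp: le_fun_def intro: order_trans)
  have "u (- y) \<le> - norm y" using u(2) q(3) by (auto simp: le_fun_def intro: order_trans)
  then have "u y \<ge> norm y" using linear_neg[OF u(1), of y] by simp
  then show ?thesis using that u(1) le by (metis antisym)
qed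

text \<open>
  A real functional \<open>u\<close> is the real part of \<open>x \<mapsto> u x - \<iota> u (\<iota> x)\<close>, which has the same norm because a value
  can be rotated onto the positive real axis. With \<open>\<iota> = 0\<close> the formula covers the real case.
\<close>

lemma (in banach_over) norming_functional:
  obtains g :: "'v \<Rightarrow> 'k" where "\<And>x y. g (x + y) = g x + g y" "\<And>c x. g (sV c x) = c * g x"
    "\<And>x. norm (g x) \<le> norm x" "g y = of_real (norm y)"
proof -
  obtain u :: "'v \<Rightarrow> real" where u: "linear u" "\<And>x. u x \<le> norm x" "u y = norm y"
    using real_norming_functional[of y] by blast
  obtain \<iota> :: 'k where \<iota>: "\<iota> = 0 \<or> \<iota> * \<iota> = -1" "norm \<iota> \<le> 1"
      "\<And>c. c = of_real (re c) - of_real (re (\<iota> * c)) * \<iota>"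
    using imaginary_unit[where 'k = 'k] by blast
  define g :: "'v \<Rightarrow> 'k" where "g x = of_real (u x) - of_real (u (sV \<iota> x)) * \<iota>" for x
  have add: "g (x + y) = g x + g y" for x y
    by (simp add: g_def linear_add[OF u(1)] scale_right_distrib algebra_simps)
  have uR: "u (sV (of_real r) x) = r * u x" for r x
    by (simp add: scale_of_real linear_scale[OF u(1)])
  have gR: "g (sV (of_real r) x) = of_real r * g x" for r x
  proof -
    have "u (sV \<iota> (sV (of_real r) x)) = r * u (sV \<iota> x)"
      by (metis uR scale_left_commute)
    then show ?thesis by (simp add: g_def uR algebra_simps)
  qed
  have gi: "g (sV \<iota> x) = \<iota> * g x" for x
  proof (cases "\<iota> = 0")
    case True
    then show ?thesis using linear_0[OF u(1)] by (simp add: g_def)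
  next
    case False
    then have i: "\<iota> * \<iota> = -1" using \<iota>(1) by simp
    have "u (sV \<iota> (sV \<iota> x)) = - u x"
      using linear_neg[OF u(1)] by (simp add: i)
    then have "g (sV \<iota> x) = of_real (u (sV \<iota> x)) + of_real (u x) * \<iota>" by (simp add: g_def)
    also have "\<dots> = of_real (u x) * \<iota> - of_real (u (sV \<iota> x)) * (\<iota> * \<iota>)" by (simp add: i)
    also have "\<dots> = \<iota> * g x" by (simp add: g_def algebra_simps)
    finally show ?thesis .
  qed
  have scale: "g (sV c x) = c * g x" for c x
  proof -
    obtain a b where c: "c = of_real a + of_real b * \<iota>" using \<iota>(3)[of c]
      by (metis diff_conv_add_uminus mult_minus_left of_real_minus)
    have "sV c x = sV (of_real a) x + sV (of_real b) (sV \<iota> x)"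
      by (simp add: c scale_left_distrib)
    then have "g (sV c x) = of_real a * g x + of_real b * (\<iota> * g x)" by (simp only: add gR gi)
    also have "\<dots> = c * g x" unfolding c by (simp only: distrib_right mult.assoc)
    finally show ?thesis .
  qed
  have re_g: "re (g x) = u x" for x
  proof (cases "\<iota> = 0")
    case False
    then have "\<iota> * \<iota> = of_real (-1)" using \<iota>(1) by simp
    then have "\<iota> = of_real (re \<iota>) - of_real (-1) * \<iota>" using \<iota>(3)[of \<iota>] by (simp only: re_of_real)
    then have "re \<iota> = 0" by simp
    then show ?thesis by (simp add: g_def re_diff re_of_real_mult)
  qed (simp add: g_def)
  have bound: "norm (g x) \<le> norm x" for x
  proof (cases "g x = 0")
    case False
    define c where "c = of_real (norm (g x)) / g x"
    have "c * g x = of_real (norm (g x))" using False by (simp add: c_def)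
    then have "u (sV c x) = norm (g x)" by (metis re_g scale re_of_real)
    moreover have "norm c = 1" using False by (simp add: c_def norm_divide)
    ultimately show ?thesis using u(2)[of "sV c x"] by (simp add: norm_scale)
  qed simp
  have "g y = of_real (norm y)"
  proof -
    have 1: "re (g y) = norm y" by (simp add: re_g u)
    have "norm (scalar_embedding (g y)) \<le> norm y" by (simp add: norm_scalar_embedding bound)
    then have "(Re (scalar_embedding (g y)))\<^sup>2 + (Im (scalar_embedding (g y)))\<^sup>2 \<le> (norm y)\<^sup>2"
      by (metis cmod_power2 norm_ge_zero power_mono)
    with 1 have "scalar_embedding (g y) = of_real (norm y)"
      by (simp add: re_def complex_eq_iff)
    then show ?thesis by (metis scalar_embedding_of_real scalar_embedding_eq_iff)
  qed
  with add scale bound show ?thesis using that by blast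
qed


section \<open>Dual spaces\<close>

text \<open>
  These properties let a vector be scaled into the unit ball, which is what the inequality
  \<open>\<parallel>f x\<parallel> \<le> \<parallel>f\<parallel> \<parallel>x\<parallel>\<close> for functionals rests on.
\<close>

definition scaled_nspace :: "('k::real_or_complex, 'v::ab_group_add) nspace \<Rightarrow> bool" where
  "scaled_nspace X \<longleftrightarrow> vecs X \<noteq> {} \<and> (\<forall>x\<in>vecs X. 0 \<le> nrm X x) \<and>
     (\<forall>c. \<forall>x\<in>vecs X. scl X c x \<in> vecs X \<and> nrm X (scl X c x) = norm c * nrm X x)"

lemma scaled_nspaceD:
  assumes "scaled_nspace X" "x \<in> vecs X"
  shows "scl X c x \<in> vecs X" "nrm X (scl X c x) = norm c * nrm X x" "0 \<le> nrm X x"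
  using assms by (auto simp: scaled_nspace_def)

text \<open>
  An inequality for the norm of a multiple suffices, since it can be applied to the inverse scalar.
\<close>

lemma scaled_nspaceI:
  assumes "vecs X \<noteq> {}" and nonneg: "\<And>x. x \<in> vecs X \<Longrightarrow> 0 \<le> nrm X x"
    and scl: "\<And>c x. x \<in> vecs X \<Longrightarrow> scl X c x \<in> vecs X"
    and le: "\<And>c x. x \<in> vecs X \<Longrightarrow> nrm X (scl X c x) \<le> norm c * nrm X x"
    and inv: "\<And>c x. x \<in> vecs X \<Longrightarrow> c \<noteq> 0 \<Longrightarrow> scl X (inverse c) (scl X c x) = x"
  shows "scaled_nspace X"
proof -
  have "nrm X (scl X c x) = norm c * nrm X x" if x: "x \<in> vecs X" for c x
  proof (cases "c = 0")
    case True
    then show ?thesis using le[OF x, of c] nonneg[OF scl[OF x, of c]] by simp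
  next
    case False
    then have "nrm X x \<le> inverse (norm c) * nrm X (scl X c x)"
      using le[OF scl[OF x, of c], of "inverse c"] inv[OF x False] by (simp add: norm_inverse)
    then have "norm c * nrm X x \<le> nrm X (scl X c x)"
      using False by (simp add: field_simps)
    then show ?thesis using le[OF x, of c] by simp
  qed
  then show ?thesis unfolding scaled_nspace_def using assms by blast
qed

lemma scl_dual: "scl (dual X) c f = (\<lambda>x. c * f x)"
  by (simp add: dual_def)

lemma dualD:
  assumes "f \<in> vecs (dual X)"
  shows "\<And>x y. x \<in> vecs X \<Longrightarrow> y \<in> vecs X \<Longrightarrow> f (x + y) = f x + f y"
    and "\<And>c x. x \<in> vecs X \<Longrightarrow> f (scl X c x) = c * f x"
    and "\<exists>B. \<forall>x\<in>vecs X. norm (f x) \<le> B * nrm X x"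
    and "\<And>x. x \<notin> vecs X \<Longrightarrow> f x = 0"
  using assms by (auto simp: dual_def)

lemma dualI:
  assumes "\<And>x y. x \<in> vecs X \<Longrightarrow> y \<in> vecs X \<Longrightarrow> f (x + y) = f x + f y"
    and "\<And>c x. x \<in> vecs X \<Longrightarrow> f (scl X c x) = c * f x"
    and "\<And>x. x \<in> vecs X \<Longrightarrow> norm (f x) \<le> B * nrm X x"
    and "\<And>x. x \<notin> vecs X \<Longrightarrow> f x = 0"
  shows "f \<in> vecs (dual X)"
  unfolding dual_def using assms by (auto intro!: exI[of _ B])

lemma dual_add: "f \<in> vecs (dual X) \<Longrightarrow> g \<in> vecs (dual X) \<Longrightarrow> f + g \<in> vecs (dual X)"
proof -
  assume f: "f \<in> vecs (dual X)" and g: "g \<in> vecs (dual X)"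
  obtain A where A: "\<forall>x\<in>vecs X. norm (f x) \<le> A * nrm X x" using dualD(3)[OF f] by blast
  obtain B where B: "\<forall>x\<in>vecs X. norm (g x) \<le> B * nrm X x" using dualD(3)[OF g] by blast
  show ?thesis
  proof (rule dualI[where B = "A + B"])
    fix x assume "x \<in> vecs X"
    then show "norm ((f + g) x) \<le> (A + B) * nrm X x"
      using A B norm_triangle_ineq[of "f x" "g x"] by (fastforce simp: algebra_simps)
  qed (auto simp: dualD[OF f] dualD[OF g] algebra_simps)
qed

lemma dual_scl: "f \<in> vecs (dual X) \<Longrightarrow> scl (dual X) c f \<in> vecs (dual X)"
proof -
  assume f: "f \<in> vecs (dual X)"
  obtain A where A: "\<forall>x\<in>vecs X. norm (f x) \<le> A * nrm X x" using dualD(3)[OF f] by blast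
  show ?thesis
  proof (rule dualI[where B = "norm c * A"])
    fix x assume "x \<in> vecs X"
    then show "norm (scl (dual X) c f x) \<le> norm c * A * nrm X x"
      using A by (auto simp: scl_dual norm_mult mult.assoc mult_left_mono)
  qed (auto simp: scl_dual dualD[OF f] algebra_simps)
qed

lemma dual_diff:
  assumes "f \<in> vecs (dual X)" "g \<in> vecs (dual X)"
  shows "f - g \<in> vecs (dual X)"
proof -
  have "f - g = f + scl (dual X) (-1) g" by (auto simp: scl_dual)
  then show ?thesis using assms dual_add dual_scl by metis
qed

lemma dual_zero: "0 \<in> vecs (dual X)"
  by (rule dualI[where B = 0]) auto

lemma nrm_dual: "nrm (dual X) f = (SUP x\<in>{x \<in> vecs X. nrm X x \<le> 1}. norm (f x))"
  by (simp add: dual_def)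

lemma unit_ball_nonempty:
  assumes "scaled_nspace X"
  shows "{x \<in> vecs X. nrm X x \<le> 1} \<noteq> {}"
proof -
  obtain x where x: "x \<in> vecs X" using assms by (auto simp: scaled_nspace_def)
  then show ?thesis using scaled_nspaceD(1,2)[OF assms x, of 0] by auto
qed

lemma nrm_dual_le:
  assumes "scaled_nspace X" "\<And>x. x \<in> vecs X \<Longrightarrow> nrm X x \<le> 1 \<Longrightarrow> norm (f x) \<le> b"
  shows "nrm (dual X) f \<le> b"
  unfolding nrm_dual using assms by (intro cSUP_least unit_ball_nonempty) auto

lemma dual_bdd:
  assumes "scaled_nspace X" "f \<in> vecs (dual X)"
  shows "bdd_above ((\<lambda>x. norm (f x)) ` {x \<in> vecs X. nrm X x \<le> 1})"
proof -
  obtain B where B: "\<And>x. x \<in> vecs X \<Longrightarrow> norm (f x) \<le> B * nrm X x" using dualD(3)[OF assms(2)] by blast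
  show ?thesis
  proof (rule bdd_aboveI2)
    fix x assume x: "x \<in> {x \<in> vecs X. nrm X x \<le> 1}"
    then have "B * nrm X x \<le> \<bar>B\<bar> * 1"
      using scaled_nspaceD(3)[OF assms(1)] by (intro mult_mono) auto
    then show "norm (f x) \<le> \<bar>B\<bar>" using B[of x] x by auto
  qed
qed

lemma norm_dual_apply_le:
  assumes "scaled_nspace X" "f \<in> vecs (dual X)" "x \<in> vecs X"
  shows "norm (f x) \<le> nrm (dual X) f * nrm X x"
proof (cases "nrm X x = 0")
  case True
  then show ?thesis using dualD(3)[OF assms(2)] assms(3) by fastforce
next
  case False
  then have pos: "nrm X x > 0" using scaled_nspaceD(3)[OF assms(1,3)] by simp
  let ?y = "scl X (of_real (inverse (nrm X x))) x"
  have "?y \<in> {x \<in> vecs X. nrm X x \<le> 1}"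
    using scaled_nspaceD[OF assms(1,3)] pos by (simp add: norm_inverse)
  then have "norm (f ?y) \<le> nrm (dual X) f"
    unfolding nrm_dual by (rule cSUP_upper[OF _ dual_bdd[OF assms(1,2)]])
  then show ?thesis using pos
    by (simp add: dualD(2)[OF assms(2,3)] norm_mult norm_divide norm_inverse field_simps)
qed

lemma nrm_dual_nonneg:
  assumes "scaled_nspace X" "f \<in> vecs (dual X)"
  shows "0 \<le> nrm (dual X) f"
proof -
  obtain x where x: "x \<in> {x \<in> vecs X. nrm X x \<le> 1}" using unit_ball_nonempty[OF assms(1)] by blast
  have "norm (f x) \<le> nrm (dual X) f"
    unfolding nrm_dual by (rule cSUP_upper[OF x dual_bdd[OF assms]])
  then show ?thesis using norm_ge_zero order_trans by blast
qed

lemma nrm_dual_le_bound: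
  assumes "scaled_nspace X" "b \<ge> 0" "\<And>x. x \<in> vecs X \<Longrightarrow> norm (f x) \<le> b * nrm X x"
  shows "nrm (dual X) f \<le> b"
proof (rule nrm_dual_le[OF assms(1)])
  fix x assume "x \<in> vecs X" "nrm X x \<le> 1"
  then show "norm (f x) \<le> b"
    using assms(3)[of x] assms(2) mult_left_le[of "nrm X x" b] by linarith
qed

lemma nrm_dual_eq_0:
  assumes "scaled_nspace X" "f \<in> vecs (dual X)" "nrm (dual X) f \<le> 0"
  shows "f = 0"
proof
  fix x
  show "f x = 0 x"
  proof (cases "x \<in> vecs X")
    case True
    then have "norm (f x) \<le> nrm (dual X) f * nrm X x" by (rule norm_dual_apply_le[OF assms(1,2)])
    also have "\<dots> \<le> 0" using assms(3) scaled_nspaceD(3)[OF assms(1) True] by (simp add: mult_nonpos_nonneg)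
    finally show ?thesis by simp
  qed (simp add: dualD(4)[OF assms(2)])
qed

lemma scaled_nspace_dual:
  assumes "scaled_nspace X"
  shows "scaled_nspace (dual X)"
proof (rule scaled_nspaceI)
  fix c f assume f: "f \<in> vecs (dual X)"
  show "nrm (dual X) (scl (dual X) c f) \<le> norm c * nrm (dual X) f"
  proof (rule nrm_dual_le_bound[OF assms])
    fix x assume "x \<in> vecs X"
    then show "norm (scl (dual X) c f x) \<le> norm c * nrm (dual X) f * nrm X x"
      using norm_dual_apply_le[OF assms f]
      by (simp add: scl_dual norm_mult mult.assoc mult_left_mono)
  qed (simp add: nrm_dual_nonneg[OF assms f])
next
  show "vecs (dual X) \<noteq> {}" using dual_zero[of X] by blast
qed (use dual_scl in \<open>auto simp: nrm_dual_nonneg[OF assms] scl_dual mult.assoc[symmetric]\<close>)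

lemma scaled_nspace_type_space:
  "banach_over sV \<Longrightarrow> scaled_nspace (type_space sV)"
  by (simp add: scaled_nspace_def type_space_def banach_over.norm_scale)

lemma type_space_simps [simp]:
  "vecs (type_space sV) = UNIV" "scl (type_space sV) = sV" "nrm (type_space sV) = norm"
  by (simp_all add: type_space_def)


section \<open>Differences of polynomials\<close>

text \<open>
  Frechet's notion of degree: all differences of order \<open>k + 1\<close> vanish. It makes induction on the degree
  possible without decomposing a polynomial into homogeneous parts.
\<close>

inductive fdegree_le :: "nat \<Rightarrow> ('e::ab_group_add \<Rightarrow> 'f::ab_group_add) \<Rightarrow> bool" where
  const: "fdegree_le 0 (\<lambda>x. c)"
| diff: "(\<And>y. fdegree_le k (\<lambda>x. P x - P (x - y))) \<Longrightarrow> fdegree_le (Suc k) P"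

lemma fdegree_le_0: "fdegree_le 0 P \<longleftrightarrow> (\<exists>c. P = (\<lambda>x. c))"
  by (subst fdegree_le.simps) auto

lemma fdegree_le_Suc: "fdegree_le (Suc k) P \<longleftrightarrow> (\<forall>y. fdegree_le k (\<lambda>x. P x - P (x - y)))"
  by (subst fdegree_le.simps) auto

lemma fdegree_le_add: "fdegree_le k P \<Longrightarrow> fdegree_le k Q \<Longrightarrow> fdegree_le k (\<lambda>x. P x + Q x)"
proof (induction k arbitrary: P Q)
  case 0
  then show ?case by (auto simp: fdegree_le_0)
next
  case (Suc k)
  have "(\<lambda>x. P x + Q x - (P (x - y) + Q (x - y))) = (\<lambda>x. (P x - P (x - y)) + (Q x - Q (x - y)))" for y
    by (auto simp: algebra_simps)
  then show ?case using Suc by (simp add: fdegree_le_Suc)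
qed

lemma fdegree_le_zero: "fdegree_le k (\<lambda>x. 0)"
  by (induction k) (auto simp: fdegree_le_Suc fdegree_le_0)

lemma n_linear_linear:
  assumes "n_linear sE sF n A" "i < n"
  shows "A (v(i := x + y)) = A (v(i := x)) + A (v(i := y))"
    and "A (v(i := x - y)) = A (v(i := x)) - A (v(i := y))"
    and "A (v(i := sE c x)) = sF c (A (v(i := x)))"
proof -
  have lin: "Vector_Spaces.linear sE sF (\<lambda>x. A (v(i := x)))"
    using assms by (simp add: n_linear_def)
  show add: "A (v(i := x + y)) = A (v(i := x)) + A (v(i := y))" for x y
    using lin by (simp add: Vector_Spaces.linear_iff)
  show "A (v(i := sE c x)) = sF c (A (v(i := x)))"
    using lin by (simp add: Vector_Spaces.linear_iff)
  show "A (v(i := x - y)) = A (v(i := x)) - A (v(i := y))"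
    using add[of "x - y" y] by simp
qed

text \<open>
  If the variable \<open>x\<close> is decreased by \<open>y\<close> in one of its \<open>card I\<close> occurrences at a time, each step
  changes the value by a map with one occurrence of \<open>x\<close> less. The shifts \<open>a i\<close> record which occurrences
  have already been decreased.
\<close>

lemma fdegree_le_n_linear:
  assumes A: "n_linear sE sF n A" and "finite I" "I \<subseteq> {..<n}"
  shows "fdegree_le (card I) (\<lambda>x. A (\<lambda>i. if i \<in> I then x + a i else v i))"
  using assms(2,3)
proof (induction "card I" arbitrary: I a v)
  case 0
  then show ?case by (auto simp: fdegree_le_0)
next
  case (Suc k)
  have "fdegree_le k (\<lambda>x. A (\<lambda>i. if i \<in> I then x + a i else v i) -
      A (\<lambda>i. if i \<in> I then x + (if i \<in> J then a i - y else a i) else v i))"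
    if "finite J" "J \<subseteq> I" for y J
    using that
  proof (induction J)
    case empty
    then show ?case by (simp add: fdegree_le_zero cong: if_cong)
  next
    case (insert j J)
    let ?b = "\<lambda>i. if i \<in> J then a i - y else a i"
    have j: "j \<in> I" "j < n" "j \<notin> J" using insert Suc.prems by auto
    have k: "k = card (I - {j})" using Suc.hyps(2) Suc.prems(1) j(1) by simp
    have "fdegree_le k (\<lambda>x. A (\<lambda>i. if i \<in> I - {j} then x + ?b i else (v(j := y)) i))"
      using Suc.hyps(1)[OF k, of ?b "v(j := y)"] Suc.prems unfolding k[symmetric] by blast
    moreover have "A (\<lambda>i. if i \<in> I - {j} then x + ?b i else (v(j := y)) i) =
        A (\<lambda>i. if i \<in> I then x + ?b i else v i) -
        A (\<lambda>i. if i \<in> I then x + (if i \<in> insert j J then a i - y else a i) else v i)" for x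
    proof -
      define w where "w i = (if i \<in> I then x + ?b i else v i)" for i
      have 1: "(\<lambda>i. if i \<in> I then x + (if i \<in> insert j J then a i - y else a i) else v i) =
          w(j := w j - y)"
        using j by (auto simp: w_def)
      have 2: "(\<lambda>i. if i \<in> I - {j} then x + ?b i else (v(j := y)) i) = w(j := y)"
        using j by (auto simp: w_def)
      have 3: "(\<lambda>i. if i \<in> I then x + ?b i else v i) = w" by (auto simp: w_def)
      show ?thesis
        unfolding 1 2 3 using n_linear_linear(2)[OF A j(2), of w "w j" y] by (simp only: fun_upd_triv) simp
    qed
    ultimately show ?case using fdegree_le_add[OF insert.IH] insert.prems by fastforce
  qed
  from this[OF Suc.prems(1) order_refl] have "fdegree_le k (\<lambda>x. A (\<lambda>i. if i \<in> I then x + a i else v i) -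
      A (\<lambda>i. if i \<in> I then x - y + a i else v i))" for y
  proof -
    have "(\<lambda>i. if i \<in> I then x + (if i \<in> I then a i - y else a i) else v i) =
        (\<lambda>i. if i \<in> I then x - y + a i else v i)" for x by auto
    then show ?thesis
      using \<open>\<And>y. fdegree_le k (\<lambda>x. A (\<lambda>i. if i \<in> I then x + a i else v i) -
        A (\<lambda>i. if i \<in> I then x + (if i \<in> I then a i - y else a i) else v i))\<close>[of y] by simp
  qed
  then show ?case by (simp add: Suc.hyps(2)[symmetric] fdegree_le_Suc)
qed

lemma homogeneous_polynomial_fdegree_le:
  assumes "homogeneous_polynomial sE sF n P"
  shows "fdegree_le n P"
proof -
  obtain A where A: "n_linear sE sF n A" "\<And>x. P x = A (\<lambda>_. x)"
    using assms by (auto simp: homogeneous_polynomial_def)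
  have "P = (\<lambda>x. A (\<lambda>i. if i \<in> {..<n} then x + 0 else 0))"
  proof
    fix x
    have "A (\<lambda>_. x) = A (\<lambda>i. if i \<in> {..<n} then x + 0 else 0)"
      using A(1) unfolding n_linear_def by simp
    then show "P x = A (\<lambda>i. if i \<in> {..<n} then x + 0 else 0)" by (simp add: A(2))
  qed
  then show ?thesis using fdegree_le_n_linear[OF A(1), of "{..<n}" "\<lambda>_. 0" "\<lambda>_. 0"] by simp
qed

section \<open>Weak continuity on bounded sets\<close>

lemma weakly_continuous_on_bounded_diff:
  fixes P :: "'e::banach \<Rightarrow> 'f::banach"
  assumes "weakly_continuous_on_bounded sE P" "weakly_continuous_on_bounded sE Q"
  shows "weakly_continuous_on_bounded sE (\<lambda>x. P x - Q x)"
  unfolding weakly_continuous_on_bounded_def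
proof (intro allI impI)
  fix G assume G: "(\<exists>R. \<forall>\<^sub>F y in G. norm y \<le> R) \<and> (\<exists>x. weakly_converges sE G x)"
  obtain l where "(P \<longlongrightarrow> l) G" using G assms(1) unfolding weakly_continuous_on_bounded_def by blast
  moreover obtain l' where "(Q \<longlongrightarrow> l') G"
    using G assms(2) unfolding weakly_continuous_on_bounded_def by blast
  ultimately have "((\<lambda>x. P x - Q x) \<longlongrightarrow> l - l') G" by (rule tendsto_diff)
  then show "\<exists>l. ((\<lambda>x. P x - Q x) \<longlongrightarrow> l) G" ..
qed

lemma weakly_continuous_on_bounded_translate:
  fixes P :: "'e::banach \<Rightarrow> 'f::banach"
  assumes "weakly_continuous_on_bounded sE P"
  shows "weakly_continuous_on_bounded sE (\<lambda>x. P (x - y))"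
  unfolding weakly_continuous_on_bounded_def
proof (intro allI impI, elim conjE exE)
  fix G R x assume R: "\<forall>\<^sub>F y in G. norm y \<le> R" and x: "weakly_converges sE G x"
  show "\<exists>l. ((\<lambda>x. P (x - y)) \<longlongrightarrow> l) G"
  proof (rule weakly_continuous_on_bounded_net[OF assms, where x = "x - y" and R = "R + norm y"])
    show "\<forall>\<^sub>F x in G. norm (x - y) \<le> R + norm y"
      using R by eventually_elim (metis add_right_mono norm_triangle_ineq4 order_trans)
    fix f assume f: "f \<in> vecs (dual (type_space sE))"
    have *: "f (x - y) = f x - f y" for x
      using dualD(1)[OF f, of "x - y" y] by simp
    show "((\<lambda>i. f (i - y)) \<longlongrightarrow> f (x - y)) G"
      unfolding * using x f by (auto simp: weakly_converges_def intro!: tendsto_diff)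
  qed
qed

text \<open>
  Along a bounded weakly Cauchy filter the differences \<open>x - y\<close> converge weakly to \<open>0\<close>, hence
  \<open>P (x - y)\<close> converges. For fixed \<open>y\<close> the map \<open>x \<mapsto> P x - P (x - y)\<close> has smaller degree, hence
  converges by the induction hypothesis; together this makes \<open>P\<close> Cauchy along the filter.
\<close>

lemma weakly_Cauchy_imp_convergent:
  fixes P :: "'e::banach \<Rightarrow> 'f::banach"
  assumes "fdegree_le k P" "weakly_continuous_on_bounded sE P"
    and bdd: "\<forall>\<^sub>F x in G. norm x \<le> R"
    and Cau: "\<And>f. f \<in> vecs (dual (type_space sE)) \<Longrightarrow> \<exists>l. (f \<longlongrightarrow> l) G"
  shows "\<exists>l. (P \<longlongrightarrow> l) G"
  using assms(1,2)
proof (induction k arbitrary: P)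
  case 0
  then show ?case by (auto simp: fdegree_le_0)
next
  case (Suc k)
  show ?case
  proof (cases "G = bot")
    case False
    have bdd2: "\<forall>\<^sub>F p in G \<times>\<^sub>F G. norm (fst p - snd p) \<le> R + R"
      unfolding eventually_prod_same using bdd
      by (intro exI[of _ "\<lambda>x. norm x \<le> R"]) (auto intro: order_trans[OF norm_triangle_ineq4] add_mono)
    have "\<exists>l. ((\<lambda>p. P (fst p - snd p)) \<longlongrightarrow> l) (G \<times>\<^sub>F G)"
    proof (rule weakly_continuous_on_bounded_net[OF Suc.prems(2) bdd2, where x = 0])
      fix f assume f: "f \<in> vecs (dual (type_space sE))"
      then obtain l where l: "(f \<longlongrightarrow> l) G" using Cau by blast
      have *: "f (x - y) = f x - f y" for x y
        using dualD(1)[OF f, of "x - y" y] by simp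
      have "((\<lambda>p. f (fst p) - f (snd p)) \<longlongrightarrow> l - l) (G \<times>\<^sub>F G)"
        by (intro tendsto_diff filterlim_compose[OF l] filterlim_fst filterlim_snd)
      moreover have "f 0 = 0" using *[of 0 0] by simp
      ultimately show "((\<lambda>p. f (fst p - snd p)) \<longlongrightarrow> f 0) (G \<times>\<^sub>F G)" by (simp add: *)
    qed
    then obtain l0 where l0: "((\<lambda>p. P (fst p - snd p)) \<longlongrightarrow> l0) (G \<times>\<^sub>F G)" ..
    have near: "\<exists>l. \<forall>\<^sub>F x in G. dist (P x) l < e" if "e > 0" for e
    proof -
      have "\<forall>\<^sub>F p in G \<times>\<^sub>F G. dist (P (fst p - snd p)) l0 < e/2"
        using tendstoD[OF l0, of "e/2"] that by simp
      then obtain Q where Q: "eventually Q G" "\<And>x y. Q x \<Longrightarrow> Q y \<Longrightarrow> dist (P (x - y)) l0 < e/2"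
        unfolding eventually_prod_same by auto
      obtain y where y: "Q y" using eventually_happens[OF Q(1)] False by (auto simp: trivial_limit_def)
      have "fdegree_le k (\<lambda>x. P x - P (x - y))" using Suc.prems(1) by (simp add: fdegree_le_Suc)
      then obtain l1 where "((\<lambda>x. P x - P (x - y)) \<longlongrightarrow> l1) G"
        using Suc.IH weakly_continuous_on_bounded_diff[OF Suc.prems(2)
            weakly_continuous_on_bounded_translate[OF Suc.prems(2)]] by blast
      then have "\<forall>\<^sub>F x in G. dist (P x - P (x - y)) l1 < e/2" using that by (intro tendstoD) auto
      then have "\<forall>\<^sub>F x in G. dist (P x) (l1 + l0) < e"
        using Q(1)
      proof eventually_elim
        case (elim x)
        have "dist (P x) (l1 + l0) \<le> dist (P x - P (x - y)) l1 + dist (P (x - y)) l0"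
          unfolding dist_norm using norm_triangle_ineq[of "P x - P (x - y) - l1" "P (x - y) - l0"]
          by (simp add: algebra_simps)
        then show ?case using elim(1) Q(2)[OF elim(2) y] by simp
      qed
      then show ?thesis ..
    qed
    have "cauchy_filter (filtermap P G)"
      unfolding cauchy_filter_metric_filtermap
    proof (intro allI impI)
      fix e :: real assume "e > 0"
      then obtain l where l: "\<forall>\<^sub>F x in G. dist (P x) l < e/2" using near[of "e/2"] by auto
      show "\<exists>Q. eventually Q G \<and> (\<forall>x y. Q x \<and> Q y \<longrightarrow> dist (P x) (P y) < e)"
        using l by (intro exI[of _ "\<lambda>x. dist (P x) l < e/2"]) (auto intro: dist_triangle_half_l)
    qed
    moreover have "complete (UNIV :: 'f set)"
      by (meson Cauchy_convergent UNIV_I complete_def convergent_def)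
    moreover have "filtermap P G \<noteq> bot" using False by (simp add: filtermap_bot_iff)
    ultimately show ?thesis
      using complete_uniform[where S = "UNIV :: 'f set"] by (force simp add: filterlim_def)
  qed simp
qed


section \<open>Spaces of polynomials\<close>

locale banach_pair = E: banach_over sE + F: banach_over sF
  for sE :: "'k::real_or_complex \<Rightarrow> 'e::banach \<Rightarrow> 'e" and sF :: "'k \<Rightarrow> 'f::banach \<Rightarrow> 'f"

lemma (in banach_over) bounded_bilinear_scale: "bounded_bilinear sV"
proof
  show "sV (a + a') b = sV a b + sV a' b" "sV a (b + b') = sV a b + sV a b'" for a a' b b'
    by (simp_all add: scale_left_distrib scale_right_distrib)
  show "sV (r *\<^sub>R a) b = r *\<^sub>R sV a b" for r a b
    by (simp add: scaleR_conv_of_real scale_of_real flip: scale_scale)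
  show "sV a (r *\<^sub>R b) = r *\<^sub>R sV a b" for r a b
    by (metis scale_left_commute scale_of_real)
  show "\<exists>K. \<forall>a b. norm (sV a b) \<le> norm a * norm b * K"
    by (rule exI[of _ 1]) (simp add: norm_scale)
qed

lemma (in banach_over) bounded_linear_dual:
  assumes "g \<in> vecs (dual (type_space sV))"
  shows "bounded_linear g"
proof -
  obtain B where B: "\<And>x. norm (g x) \<le> B * norm x" using dualD(3)[OF assms] by auto
  show ?thesis
  proof (rule bounded_linear_intro)
    show "g (x + y) = g x + g y" for x y using dualD(1)[OF assms] by simp
    show "g (r *\<^sub>R x) = r *\<^sub>R g x" for r x
      using dualD(2)[OF assms, of x "of_real r"] by (simp add: scale_of_real scaleR_conv_of_real)
    show "norm (g x) \<le> norm x * B" for x using B by (simp add: mult.commute)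
  qed
qed

context banach_pair
begin

lemma homogeneous_polynomial_scale:
  assumes "homogeneous_polynomial sE sF n P"
  shows "P (sE c x) = sF (c ^ n) (P x)"
proof -
  obtain A where A: "n_linear sE sF n A" "\<And>x. P x = A (\<lambda>_. x)"
    using assms by (auto simp: homogeneous_polynomial_def)
  have "A (\<lambda>i. if i < k then sE c x else x) = sF (c ^ k) (A (\<lambda>_. x))" if "k \<le> n" for k
    using that
  proof (induction k)
    case (Suc k)
    let ?w = "\<lambda>i. if i < k then sE c x else x"
    have "(\<lambda>i. if i < Suc k then sE c x else x) = ?w(k := sE c x)" by (auto simp: less_Suc_eq)
    moreover have "?w(k := x) = ?w" by auto
    ultimately have "A (\<lambda>i. if i < Suc k then sE c x else x) = sF c (A ?w)"
      using n_linear_linear(3)[OF A(1), of k ?w c x] Suc.prems by simp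
    then show ?case using Suc by simp
  qed simp
  moreover have "A (\<lambda>_. sE c x) = A (\<lambda>i. if i < n then sE c x else x)"
    using A(1) unfolding n_linear_def by simp
  ultimately show ?thesis by (simp add: A(2))
qed

lemma poly_space_simps:
  "vecs (poly_space sE sF n) = {P. homogeneous_polynomial sE sF n P \<and> continuous_on UNIV P}"
  "scl (poly_space sE sF n) = (\<lambda>c P x. sF c (P x))"
  "nrm (poly_space sE sF n) = (\<lambda>P. SUP x\<in>cball 0 1. norm (P x))"
  by (simp_all add: poly_space_def)

text \<open>
  Continuity at \<open>0\<close> gives a bound on a small ball, and homogeneity carries it over to the unit ball.
\<close>

lemma poly_bdd:
  assumes "P \<in> vecs (poly_space sE sF n)"
  shows "bdd_above ((\<lambda>x. norm (P x)) ` cball 0 1)"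
proof -
  have P: "homogeneous_polynomial sE sF n P" "continuous_on UNIV P"
    using assms by (auto simp: poly_space_simps)
  then have "isCont P 0" by (simp add: continuous_on_eq_continuous_at)
  then obtain d where d: "d > 0" "\<And>x. dist x 0 < d \<Longrightarrow> dist (P x) (P 0) < 1"
    unfolding continuous_at_eps_delta by (metis zero_less_one)
  define c where "c = d / 2"
  have c: "c > 0" "c < d" using d(1) by (auto simp: c_def)
  show ?thesis
  proof (rule bdd_aboveI2)
    fix x :: 'e assume x: "x \<in> cball 0 1"
    have "norm (sE (of_real c) x) \<le> c" using x c by (simp add: E.norm_scale mult_left_le)
    then have "dist (P (sE (of_real c) x)) (P 0) < 1" using c by (intro d(2)) simp
    then have "norm (P (sE (of_real c) x)) \<le> 1 + norm (P 0)"
      by (smt (verit) dist_norm norm_triangle_sub)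
    then have "c ^ n * norm (P x) \<le> 1 + norm (P 0)"
      using c by (simp add: homogeneous_polynomial_scale[OF P(1)] F.norm_scale norm_power)
    then show "norm (P x) \<le> (1 + norm (P 0)) / c ^ n" using c by (simp add: field_simps)
  qed
qed

lemma norm_poly_le:
  "P \<in> vecs (poly_space sE sF n) \<Longrightarrow> norm x \<le> 1 \<Longrightarrow> norm (P x) \<le> nrm (poly_space sE sF n) P"
  unfolding poly_space_simps(3) by (rule cSUP_upper) (auto intro: poly_bdd)

lemma nrm_poly_le:
  "(\<And>x. norm x \<le> 1 \<Longrightarrow> norm (P x) \<le> b) \<Longrightarrow> nrm (poly_space sE sF n) P \<le> b"
  unfolding poly_space_simps(3) by (rule cSUP_least) auto

lemma poly_add:
  assumes "P \<in> vecs (poly_space sE sF n)" "Q \<in> vecs (poly_space sE sF n)"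
  shows "P + Q \<in> vecs (poly_space sE sF n)"
proof -
  obtain A B where AB: "n_linear sE sF n A" "\<And>x. P x = A (\<lambda>_. x)" "n_linear sE sF n B" "\<And>x. Q x = B (\<lambda>_. x)"
    using assms by (auto simp: poly_space_simps homogeneous_polynomial_def)
  have "n_linear sE sF n (\<lambda>v. A v + B v)"
    using AB(1,3) unfolding n_linear_def Vector_Spaces.linear_iff
    by (simp add: F.scale_right_distrib algebra_simps) metis
  then have "homogeneous_polynomial sE sF n (P + Q)"
    unfolding homogeneous_polynomial_def using AB(2,4) by auto
  moreover have "continuous_on UNIV (P + Q)"
    using assms continuous_on_add[of UNIV P Q] by (simp add: poly_space_simps plus_fun_def)
  ultimately show ?thesis by (simp add: poly_space_simps)
qed

lemma poly_scale:
  assumes "P \<in> vecs (poly_space sE sF n)"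
  shows "(\<lambda>x. sF c (P x)) \<in> vecs (poly_space sE sF n)"
proof -
  obtain A where A: "n_linear sE sF n A" "\<And>x. P x = A (\<lambda>_. x)"
    using assms by (auto simp: poly_space_simps homogeneous_polynomial_def)
  have "n_linear sE sF n (\<lambda>v. sF c (A v))"
    using A(1) unfolding n_linear_def Vector_Spaces.linear_iff
    by (simp add: F.scale_right_distrib mult.commute)
  then have "homogeneous_polynomial sE sF n (\<lambda>x. sF c (P x))"
    unfolding homogeneous_polynomial_def using A(2) by auto
  moreover have "continuous_on UNIV (\<lambda>x. sF c (P x))"
    using assms by (intro bounded_bilinear.continuous_on[OF F.bounded_bilinear_scale])
      (auto simp: poly_space_simps)
  ultimately show ?thesis by (simp add: poly_space_simps)
qed

text \<open>
  All test polynomials are of this form; \<open>T\<close> is the quotient mapping or an operator of rank one.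
\<close>

lemma functional_power_times_operator:
  assumes g: "g \<in> vecs (dual (type_space sE))"
    and T: "Vector_Spaces.linear sE sF T" "continuous_on UNIV T"
  shows "(\<lambda>x. sF (g x ^ m) (T x)) \<in> vecs (poly_space sE sF (Suc m))"
proof -
  let ?A = "\<lambda>v. sF (\<Prod>j<m. g (v j)) (T (v m))"
  have glin: "g (x + y) = g x + g y" "g (sE c x) = c * g x" for x y c
    using dualD(1,2)[OF g] by simp_all
  have Tlin: "T (x + y) = T x + T y" "T (sE c x) = sF c (T x)" for x y c
    using T(1) by (simp_all add: Vector_Spaces.linear_iff)
  have "n_linear sE sF (Suc m) ?A" unfolding n_linear_def
  proof (intro conjI allI impI)
    fix v :: "nat \<Rightarrow> 'e" and i assume i: "i < Suc m"
    show "Vector_Spaces.linear sE sF (\<lambda>x. ?A (v(i := x)))"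
    proof (cases "i = m")
      case True
      then have "?A (v(i := x)) = sF (\<Prod>j<m. g (v j)) (T x)" for x by simp
      then show ?thesis unfolding Vector_Spaces.linear_iff
        using E.vector_space_axioms F.vector_space_axioms
        by (simp add: Tlin F.scale_right_distrib mult.commute)
    next
      case False
      then have im: "i \<in> {..<m}" using i by simp
      have "(\<Prod>j<m. g ((v(i := x)) j)) = g x * (\<Prod>j\<in>{..<m} - {i}. g (v j))" for x
        by (subst prod.remove[OF _ im]) (auto intro!: prod.cong)
      then have "?A (v(i := x)) = sF (g x * (\<Prod>j\<in>{..<m} - {i}. g (v j))) (T (v m))" for x
        using False by simp
      then show ?thesis unfolding Vector_Spaces.linear_iff
        using E.vector_space_axioms F.vector_space_axioms
        by (simp add: glin F.scale_left_distrib distrib_right mult.assoc)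
    qed
  next
    fix v w :: "nat \<Rightarrow> 'e" assume "\<forall>i<Suc m. v i = w i"
    then show "?A v = ?A w" by simp
  qed
  then have "homogeneous_polynomial sE sF (Suc m) (\<lambda>x. sF (g x ^ m) (T x))"
    unfolding homogeneous_polynomial_def by (intro exI[of _ ?A]) simp
  moreover have "continuous_on UNIV g"
    using E.bounded_linear_dual[OF g] by (rule linear_continuous_on)
  then have "continuous_on UNIV (\<lambda>x. sF (g x ^ m) (T x))"
    by (intro bounded_bilinear.continuous_on[OF F.bounded_bilinear_scale] continuous_on_power T(2))
  ultimately show ?thesis by (simp add: poly_space_simps)
qed

lemma scaled_nspace_poly: "scaled_nspace (poly_space sE sF n)"
proof (rule scaled_nspaceI)
  have "n_linear sE sF n (\<lambda>v. 0)"
    unfolding n_linear_def Vector_Spaces.linear_iff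
    using E.vector_space_axioms F.vector_space_axioms by simp
  then have "(\<lambda>x. 0) \<in> vecs (poly_space sE sF n)"
    by (auto simp: poly_space_simps homogeneous_polynomial_def)
  then show "vecs (poly_space sE sF n) \<noteq> {}" by blast
next
  fix P assume P: "P \<in> vecs (poly_space sE sF n)"
  show "0 \<le> nrm (poly_space sE sF n) P"
    using norm_poly_le[OF P, of 0] order_trans[OF norm_ge_zero[of "P 0"]] by simp
  fix c
  show "scl (poly_space sE sF n) c P \<in> vecs (poly_space sE sF n)"
    using poly_scale[OF P] by (simp add: poly_space_simps(2))
  show "nrm (poly_space sE sF n) (scl (poly_space sE sF n) c P) \<le> norm c * nrm (poly_space sE sF n) P"
    using norm_poly_le[OF P] by (intro nrm_poly_le) (simp add: poly_space_simps(2) F.norm_scale mult_left_mono)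
  assume "c \<noteq> 0"
  then show "scl (poly_space sE sF n) (inverse c) (scl (poly_space sE sF n) c P) = P"
    by (simp add: poly_space_simps(2))
qed

lemma finite_type_polynomial_weakly_continuous:
  assumes "g \<in> vecs (dual (type_space sE))"
  shows "(\<lambda>x. sF (g x ^ m) (sF (g x) y)) \<in> wpoly_subspace sE sF (Suc m)"
proof -
  have g: "g (x + x') = g x + g x'" "g (sE c x) = c * g x" for x x' c
    using dualD(1,2)[OF assms] by simp_all
  have "Vector_Spaces.linear sE sF (\<lambda>x. sF (g x) y)"
    unfolding Vector_Spaces.linear_iff using E.vector_space_axioms F.vector_space_axioms
    by (simp add: g F.scale_left_distrib)
  moreover have "continuous_on UNIV (\<lambda>x. sF (g x) y)"
    using E.bounded_linear_dual[OF assms]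
    by (intro bounded_bilinear.continuous_on[OF F.bounded_bilinear_scale] linear_continuous_on continuous_on_const)
  moreover have "weakly_continuous_on_bounded sE (\<lambda>x. sF (g x ^ m) (sF (g x) y))"
    unfolding weakly_continuous_on_bounded_def
  proof (intro allI impI, elim conjE exE)
    fix G x assume "weakly_converges sE G x"
    then have "(g \<longlongrightarrow> g x) G" using assms by (simp add: weakly_converges_def)
    then have "((\<lambda>x. sF (g x ^ m) (sF (g x) y)) \<longlongrightarrow> sF (g x ^ m) (sF (g x) y)) G"
      by (intro bounded_bilinear.tendsto[OF F.bounded_bilinear_scale] tendsto_power tendsto_const)
    then show "\<exists>l. ((\<lambda>x. sF (g x ^ m) (sF (g x) y)) \<longlongrightarrow> l) G" ..
  qed
  ultimately show ?thesis
    using functional_power_times_operator[OF assms, of "\<lambda>x. sF (g x) y" m] unfolding wpoly_subspace_def by blast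
qed

end


section \<open>The bidual\<close>

context banach_over
begin

abbreviation "X' \<equiv> dual (type_space sV)"
abbreviation "X'' \<equiv> dual (dual (type_space sV))"

lemma scaled_nspaces: "scaled_nspace (type_space sV)" "scaled_nspace X'" "scaled_nspace X''"
proof -
  show "scaled_nspace (type_space sV)"
    by (rule scaled_nspace_type_space) (rule banach_over_axioms)
  then show "scaled_nspace X'" by (rule scaled_nspace_dual)
  then show "scaled_nspace X''" by (rule scaled_nspace_dual)
qed

lemma canonical_embedding_apply:
  "g \<in> vecs X' \<Longrightarrow> canonical_embedding (type_space sV) x g = g x"
  by (simp add: canonical_embedding_def)

lemma canonical_embedding_in_bidual: "canonical_embedding (type_space sV) x \<in> vecs X''"
proof (rule dualI[where B = "norm x"])
  fix g assume g: "g \<in> vecs X'"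
  then show "norm (canonical_embedding (type_space sV) x g) \<le> norm x * nrm X' g"
    using norm_dual_apply_le[OF scaled_nspaces(1) g, of x] by (simp add: canonical_embedding_def mult.commute)
qed (auto simp: canonical_embedding_def dual_add dual_scl scl_dual dual_scl[unfolded scl_dual])

lemma bidual_eqI:
  assumes "z \<in> vecs X''" "w \<in> vecs X''" "\<And>g. g \<in> vecs X' \<Longrightarrow> z g = w g"
  shows "z = w"
  using assms dualD(4)[OF assms(1)] dualD(4)[OF assms(2)] by (metis ext)

lemma canonical_embedding_add:
  "canonical_embedding (type_space sV) (x + y) =
    canonical_embedding (type_space sV) x + canonical_embedding (type_space sV) y"
  by (rule bidual_eqI)
    (auto simp: canonical_embedding_in_bidual dual_add canonical_embedding_apply dualD(1))

lemma canonical_embedding_scale: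
  "canonical_embedding (type_space sV) (sV c x) = scl X'' c (canonical_embedding (type_space sV) x)"
proof (rule bidual_eqI)
  fix g assume g: "g \<in> vecs X'"
  then show "canonical_embedding (type_space sV) (sV c x) g = scl X'' c (canonical_embedding (type_space sV) x) g"
    using dualD(2)[OF g, of x c] by (simp add: canonical_embedding_apply scl_dual)
qed (auto simp: canonical_embedding_in_bidual dual_scl)

lemma norming_element_of_dual:
  obtains g where "g \<in> vecs X'" "nrm X' g \<le> 1" "g y = of_real (norm y)"
proof -
  obtain g :: "'v \<Rightarrow> 'k" where g: "\<And>x y. g (x + y) = g x + g y" "\<And>c x. g (sV c x) = c * g x"
    "\<And>x. norm (g x) \<le> norm x" "g y = of_real (norm y)"
    using norming_functional[of y] by blast
  have "g \<in> vecs X'"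
    by (rule dualI[where B = 1]) (auto simp: g)
  moreover have "nrm X' g \<le> 1"
    by (rule nrm_dual_le_bound[OF scaled_nspaces(1)]) (auto simp: g(3))
  ultimately show ?thesis using that g(4) by blast
qed

text \<open>
  Points \<open>J (y n)\<close> that approximate \<open>z\<close> in norm come from a Cauchy sequence \<open>y\<close>, because the distance of
  two points of \<open>y\<close> is attained by a functional of norm at most \<open>1\<close>; the limit of \<open>y\<close> represents \<open>z\<close>.
\<close>

lemma closed_subspace_canonical_embedding:
  "closed_subspace X'' (range (canonical_embedding (type_space sV)))"
  unfolding closed_subspace_def
proof (intro conjI ballI allI impI)
  let ?J = "canonical_embedding (type_space sV)"
  show "range ?J \<subseteq> vecs X''" using canonical_embedding_in_bidual by blast
  have "?J 0 = 0"
    using canonical_embedding_add[of 0 0] by simp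
  then show "0 \<in> range ?J" by (metis rangeI)
  show "z + w \<in> range ?J" if "z \<in> range ?J" "w \<in> range ?J" for z w
    using that by (auto simp flip: canonical_embedding_add)
  show "scl X'' c z \<in> range ?J" if "z \<in> range ?J" for c z
    using that by (auto simp flip: canonical_embedding_scale)
  fix z assume z: "z \<in> vecs X''" and approx: "\<forall>e>0. \<exists>w\<in>range ?J. nrm X'' (z - w) < e"
  have "\<exists>y. nrm X'' (z - ?J y) < inverse (real (Suc n))" for n
    using approx by (metis imageE inverse_positive_iff_positive of_nat_0_less_iff zero_less_Suc)
  then obtain y where y: "\<And>n. nrm X'' (z - ?J (y n)) < inverse (real (Suc n))" by metis
  have bound: "norm (z g - g (y n)) \<le> inverse (real (Suc n)) * nrm X' g" if g: "g \<in> vecs X'" for g n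
  proof -
    have "norm ((z - ?J (y n)) g) \<le> nrm X'' (z - ?J (y n)) * nrm X' g"
      by (rule norm_dual_apply_le[OF scaled_nspaces(2) dual_diff[OF z canonical_embedding_in_bidual] g])
    also have "\<dots> \<le> inverse (real (Suc n)) * nrm X' g"
      using y[of n] nrm_dual_nonneg[OF scaled_nspaces(1) g] by (intro mult_right_mono) auto
    finally show ?thesis by (simp add: canonical_embedding_apply[OF g])
  qed
  have dist: "norm (y m - y n) \<le> inverse (real (Suc m)) + inverse (real (Suc n))" for m n
  proof -
    obtain g where g: "g \<in> vecs X'" "nrm X' g \<le> 1" "g (y m - y n) = of_real (norm (y m - y n))"
      using norming_element_of_dual[of "y m - y n"] .
    have le1: "norm (z g - g (y k)) \<le> inverse (real (Suc k))" for k
      using bound[OF g(1), of k] g(2) nrm_dual_nonneg[OF scaled_nspaces(1) g(1)]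
      by (meson inverse_nonnegative_iff_nonnegative mult_left_le of_nat_0_le_iff order_trans)
    have "g (y m - y n) = g (y m) - g (y n)" using dualD(1)[OF g(1), of "y m - y n" "y n"] by simp
    then have "norm (y m - y n) = norm ((z g - g (y n)) - (z g - g (y m)))"
      using arg_cong[OF g(3), of norm] by simp
    also have "\<dots> \<le> inverse (real (Suc m)) + inverse (real (Suc n))"
      using norm_triangle_ineq4[of "z g - g (y n)" "z g - g (y m)"] le1[of m] le1[of n] by linarith
    finally show ?thesis .
  qed
  have "Cauchy y"
  proof (rule metric_CauchyI)
    fix e :: real assume "e > 0"
    then obtain N where N: "inverse (real (Suc N)) < e / 2" using reals_Archimedean[of "e/2"] by auto
    show "\<exists>M. \<forall>m\<ge>M. \<forall>n\<ge>M. dist (y m) (y n) < e"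
    proof (intro exI allI impI)
      fix m n assume mn: "m \<ge> N" "n \<ge> N"
      then have "inverse (real (Suc m)) \<le> inverse (real (Suc N))" "inverse (real (Suc n)) \<le> inverse (real (Suc N))"
        by (auto intro!: le_imp_inverse_le)
      then show "dist (y m) (y n) < e" using dist[of m n] N unfolding dist_norm by linarith
    qed
  qed
  then obtain l where l: "y \<longlonglongrightarrow> l" using Cauchy_convergent convergent_def by blast
  have "z = ?J l"
  proof (rule bidual_eqI[OF z canonical_embedding_in_bidual])
    fix g assume g: "g \<in> vecs X'"
    have "(\<lambda>n. inverse (real (Suc n)) * nrm X' g) \<longlonglongrightarrow> 0 * nrm X' g"
      by (intro tendsto_mult LIMSEQ_inverse_real_of_nat tendsto_const)
    then have null: "(\<lambda>n. inverse (real (Suc n)) * nrm X' g) \<longlonglongrightarrow> 0" by simp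
    have "(\<lambda>n. z g - g (y n)) \<longlonglongrightarrow> 0"
      by (rule Lim_null_comparison[OF always_eventually[OF allI[OF bound[OF g]]] null])
    moreover have "(\<lambda>n. z g - g (y n)) \<longlonglongrightarrow> z g - g l"
      using bounded_linear.tendsto[OF bounded_linear_dual[OF g] l] by (intro tendsto_diff tendsto_const)
    ultimately have "z g - g l = 0" using LIMSEQ_unique by blast
    then show "z g = ?J l g" by (simp add: canonical_embedding_apply[OF g])
  qed
  then show "z \<in> range ?J" by blast
qed

text \<open>
  A value \<open>h x\<close> can be rotated onto the positive real axis; the factor \<open>r < 1\<close> moves \<open>x\<close> into the open ball.
\<close>

lemma nrm_le_of_re_le:
  assumes h: "h \<in> vecs X'" and s: "\<And>x. norm x < 1 \<Longrightarrow> re (h x) \<le> s"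
  shows "nrm X' h \<le> s"
proof (rule nrm_dual_le[OF scaled_nspaces(1)])
  fix x :: 'v assume "nrm (type_space sV) x \<le> 1"
  then have x: "norm x \<le> 1" by simp
  show "norm (h x) \<le> s"
  proof (rule field_le_mult_one_interval)
    fix r :: real assume r: "0 < r" "r < 1"
    define u :: 'k where "u = (if h x = 0 then 0 else of_real (r * norm (h x)) / h x)"
    have "u * h x = of_real (r * norm (h x))" by (simp add: u_def)
    then have "re (h (sV u x)) = r * norm (h x)"
      using dualD(2)[OF h, of x u] by (metis UNIV_I re_of_real type_space_simps(1,2))
    moreover have "norm u \<le> r" using r by (simp add: u_def norm_divide norm_mult)
    then have "norm (sV u x) < 1"
      using x r by (metis le_less_trans mult_left_le norm_ge_zero norm_scale order_trans)
    ultimately show "r * norm (h x) \<le> s" using s by metis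
  qed
qed

lemma dual_real_combination:
  assumes "finite S" "S \<subseteq> vecs X'"
  shows "(\<lambda>x. \<Sum>g\<in>S. of_real (c g) * g x) \<in> vecs X'"
    and "z \<in> vecs X'' \<Longrightarrow> z (\<lambda>x. \<Sum>g\<in>S. of_real (c g) * g x) = (\<Sum>g\<in>S. of_real (c g) * z g)"
proof -
  have "(\<lambda>x. \<Sum>g\<in>S. of_real (c g) * g x) \<in> vecs X' \<and>
      (z \<in> vecs X'' \<longrightarrow> z (\<lambda>x. \<Sum>g\<in>S. of_real (c g) * g x) = (\<Sum>g\<in>S. of_real (c g) * z g))"
    using assms
  proof (induction S)
    case empty
    have "(\<lambda>x::'v. 0::'k) \<in> vecs X'" using dual_zero[of "type_space sV"] by (simp add: zero_fun_def)
    moreover have "z (\<lambda>x. 0) = 0" if "z \<in> vecs X''"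
      using dualD(2)[OF that, of "\<lambda>x. 0" 0] calculation by (simp add: scl_dual)
    ultimately show ?case by simp
  next
    case (insert g S)
    have eq: "(\<lambda>x. \<Sum>g\<in>insert g S. of_real (c g) * g x) =
        scl X' (of_real (c g)) g + (\<lambda>x. \<Sum>g\<in>S. of_real (c g) * g x)"
      using insert by (auto simp: scl_dual)
    have g: "g \<in> vecs X'" using insert by simp
    have S: "(\<lambda>x. \<Sum>g\<in>S. of_real (c g) * g x) \<in> vecs X'" using insert by simp
    show ?case unfolding eq using insert dual_add[OF dual_scl[OF g] S]
      by (auto simp: dualD(1)[where X = X'] dualD(2)[where X = X'] g S dual_scl)
  qed
  then show "(\<lambda>x. \<Sum>g\<in>S. of_real (c g) * g x) \<in> vecs X'"
    and "z \<in> vecs X'' \<Longrightarrow> z (\<lambda>x. \<Sum>g\<in>S. of_real (c g) * g x) = (\<Sum>g\<in>S. of_real (c g) * z g)"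
    by blast+
qed

text \<open>
  A variational argument replaces the separation of convex sets in finite dimension. If the squared
  distance \<open>Q y\<close> of \<open>(re (g y))\<close> to \<open>(re (z g))\<close>, with \<open>g\<close> ranging over \<open>S\<close>, had a positive infimum \<open>m\<close>
  over the ball, take \<open>y\<close> that is almost minimal. Moving from \<open>y\<close> towards an arbitrary \<open>y'\<close> of the ball
  cannot lower \<open>Q\<close> by much, so the real part of the functional \<open>h = - \<Sum> d g \<cdot> g\<close>, with residuals
  \<open>d g = re (g y) - re (z g)\<close>, almost attains its supremum, the norm of \<open>h\<close>, at \<open>y\<close>. As
  \<open>re (z h) \<le> \<parallel>h\<parallel>\<close>, this makes \<open>Q y = re (z h) - re (h y)\<close> smaller than \<open>m\<close>.
\<close>

lemma Helly_real:
  assumes z: "z \<in> vecs X''" "nrm X'' z \<le> 1" and S: "finite S" "S \<subseteq> vecs X'" and e: "e > 0"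
  obtains y where "norm y < 1" "\<And>g. g \<in> S \<Longrightarrow> \<bar>re (g y) - re (z g)\<bar> < e"
proof -
  define Q where "Q y = (\<Sum>g\<in>S. (re (g y) - re (z g))\<^sup>2)" for y
  have "\<exists>y\<in>ball 0 1. Q y < e\<^sup>2"
  proof (rule ccontr)
    assume "\<not> ?thesis"
    then have ge: "e\<^sup>2 \<le> Q y" if "norm y < 1" for y using that by (auto simp: not_less)
    define m where "m = (INF y\<in>ball 0 1. Q y)"
    have bdd: "bdd_below (Q ` ball 0 1)" using ge by (intro bdd_belowI2[where m = "e\<^sup>2"]) auto
    have m: "m \<le> Q y" if "norm y < 1" for y
      unfolding m_def using that by (intro cINF_lower bdd) auto
    have "e\<^sup>2 \<le> m" unfolding m_def using ge by (intro cINF_greatest) auto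
    then have mpos: "m > 0" using e by (smt (verit) zero_less_power)
    define M where "M = (\<Sum>g\<in>S. (2 * nrm X' g)\<^sup>2)"
    have M0: "M \<ge> 0" unfolding M_def by (intro sum_nonneg) auto
    \<comment> \<open>The step \<open>t\<close> is so small that the quadratic term \<open>t\<^sup>2 M\<close> is at most \<open>t m / 2\<close>.\<close>
    define t where "t = min 1 (m / (2 * (M + 1)))"
    have t: "0 < t" "t \<le> 1" using mpos M0 by (auto simp: t_def)
    have "t * M \<le> t * (M + 1)" using t by (simp add: mult_left_mono)
    also have "\<dots> \<le> m / (2 * (M + 1)) * (M + 1)" using M0 by (intro mult_right_mono) (auto simp: t_def)
    also have "\<dots> = m / 2" using M0 by (simp add: field_simps)
    finally have tM: "t * M \<le> m / 2" .
    have "\<exists>y\<in>ball 0 1. Q y < m + t * m / 2"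
    proof (rule ccontr)
      assume "\<not> ?thesis"
      then have "m + t * m / 2 \<le> m" by (subst (2) m_def) (intro cINF_greatest, auto simp: not_less)
      then show False using mult_pos_pos[OF t(1) mpos] by simp
    qed
    then obtain y where y: "norm y < 1" "Q y < m + t * m / 2" by auto
    define d where "d g = re (g y) - re (z g)" for g
    have gadd: "g (a + b) = g a + g b" if "g \<in> S" for g a b
      using dualD(1)[of g "type_space sV" a b] that S(2) by auto
    have gdiff: "g (a - b) = g a - g b" if "g \<in> S" for g a b
      using gadd[OF that, of "a - b" b] by simp
    have gscale: "g (r *\<^sub>R a) = of_real r * g a" if "g \<in> S" for g a r
      using dualD(2)[of g "type_space sV" a "of_real r"] that S(2) by (auto simp: scale_of_real)
    have lower: "- (m / 2) < (\<Sum>g\<in>S. d g * re (g (y' - y)))" if y': "norm y' < 1" for y'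
    proof -
      have "y + t *\<^sub>R (y' - y) = (1 - t) *\<^sub>R y + t *\<^sub>R y'" by (simp add: algebra_simps)
      also have "norm \<dots> < 1"
        using convexD[OF convex_ball[of "0::'v" 1], of y y' "1 - t" t] y(1) y' t by simp
      finally have "m \<le> Q (y + t *\<^sub>R (y' - y))" by (rule m)
      also have "Q (y + t *\<^sub>R (y' - y)) = (\<Sum>g\<in>S. (d g + t * re (g (y' - y)))\<^sup>2)"
        unfolding Q_def d_def
        by (intro sum.cong refl) (simp only: gadd gscale re_add re_of_real_mult, simp add: algebra_simps)
      also have "\<dots> = Q y + 2 * t * (\<Sum>g\<in>S. d g * re (g (y' - y))) + t\<^sup>2 * (\<Sum>g\<in>S. (re (g (y' - y)))\<^sup>2)"
        unfolding Q_def d_def[symmetric] sum_distrib_left sum.distrib[symmetric]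
        by (intro sum.cong refl) (simp add: power2_eq_square algebra_simps)
      also have "(\<Sum>g\<in>S. (re (g (y' - y)))\<^sup>2) \<le> M" unfolding M_def
      proof (rule sum_mono)
        fix g assume g: "g \<in> S"
        then have g': "g \<in> vecs X'" using S by auto
        have "norm (g (y' - y)) \<le> nrm X' g * norm (y' - y)"
          using norm_dual_apply_le[OF scaled_nspaces(1) g', of "y' - y"] by simp
        also have "\<dots> \<le> nrm X' g * 2"
          using norm_triangle_ineq4[of y' y] y(1) y' nrm_dual_nonneg[OF scaled_nspaces(1) g']
          by (intro mult_left_mono) auto
        finally have "\<bar>re (g (y' - y))\<bar> \<le> 2 * nrm X' g"
          using abs_re_le[of "g (y' - y)"] by linarith
        then show "(re (g (y' - y)))\<^sup>2 \<le> (2 * nrm X' g)\<^sup>2" by (metis abs_ge_zero power2_abs power_mono)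
      qed
      finally have "m \<le> Q y + 2 * t * (\<Sum>g\<in>S. d g * re (g (y' - y))) + t\<^sup>2 * M"
        by (simp add: mult_left_mono)
      then have "0 < t * m / 2 + 2 * t * (\<Sum>g\<in>S. d g * re (g (y' - y))) + t\<^sup>2 * M"
        using y(2) by linarith
      also have "\<dots> = t * (m / 2 + 2 * (\<Sum>g\<in>S. d g * re (g (y' - y))) + t * M)"
        by (simp add: power2_eq_square algebra_simps)
      finally have "0 < m / 2 + 2 * (\<Sum>g\<in>S. d g * re (g (y' - y))) + t * M"
        using t(1) by (simp add: zero_less_mult_iff)
      then show ?thesis using tM by linarith
    qed
    define h where "h x = (\<Sum>g\<in>S. of_real (- d g) * g x)" for x
    have h: "h \<in> vecs X'" unfolding h_def using dual_real_combination(1)[OF S] .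
    have zh: "z h = (\<Sum>g\<in>S. of_real (- d g) * z g)"
      unfolding h_def using dual_real_combination(2)[OF S z(1)] .
    have re_comb: "re (\<Sum>g\<in>S. of_real (- d g) * w g) = - (\<Sum>g\<in>S. d g * re (w g))" for w
      unfolding re_sum re_of_real_mult by (simp add: sum_negf)
    let ?s = "m / 2 - (\<Sum>g\<in>S. d g * re (g y))"
    have "nrm X' h \<le> ?s"
    proof (rule nrm_le_of_re_le[OF h])
      fix y' :: 'v assume "norm y' < 1"
      then have "- (m / 2) < (\<Sum>g\<in>S. d g * re (g (y' - y)))" by (rule lower)
      also have "\<dots> = (\<Sum>g\<in>S. d g * re (g y')) - (\<Sum>g\<in>S. d g * re (g y))"
        unfolding sum_subtractf[symmetric]
        by (intro sum.cong refl) (simp add: gdiff re_diff algebra_simps)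
      finally show "re (h y') \<le> ?s" unfolding h_def re_comb by simp
    qed
    moreover have "re (z h) \<le> nrm X' h"
    proof -
      have "re (z h) \<le> norm (z h)" using abs_re_le[of "z h"] by linarith
      also have "\<dots> \<le> nrm X'' z * nrm X' h" by (rule norm_dual_apply_le[OF scaled_nspaces(2) z(1) h])
      also have "\<dots> \<le> nrm X' h"
        using z(2) nrm_dual_nonneg[OF scaled_nspaces(1) h] by (simp add: mult_left_le_one_le nrm_dual_nonneg[OF scaled_nspaces(2) z(1)])
      finally show ?thesis .
    qed
    ultimately have "(\<Sum>g\<in>S. d g * re (g y)) - (\<Sum>g\<in>S. d g * re (z g)) \<le> m / 2"
      unfolding zh re_comb by linarith
    also have "(\<Sum>g\<in>S. d g * re (g y)) - (\<Sum>g\<in>S. d g * re (z g)) = Q y"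
      unfolding Q_def sum_subtractf[symmetric] d_def
      by (intro sum.cong refl) (simp add: power2_eq_square algebra_simps)
    finally show False using m[OF y(1)] mpos by linarith
  qed
  then obtain y where y: "norm y < 1" "Q y < e\<^sup>2" by auto
  show ?thesis
  proof (rule that[OF y(1)])
    fix g assume "g \<in> S"
    then have "(re (g y) - re (z g))\<^sup>2 \<le> Q y" unfolding Q_def using S(1) by (intro member_le_sum) auto
    then have "(re (g y) - re (z g))\<^sup>2 < e\<^sup>2" using y(2) by linarith
    then show "\<bar>re (g y) - re (z g)\<bar> < e" using e abs_le_square_iff[of e "re (g y) - re (z g)"] by linarith
  qed
qed

text \<open>
  Real parts determine scalars once the functionals \<open>\<iota> g\<close> are added to the functionals \<open>g\<close>.
\<close>

lemma Helly:
  assumes z: "z \<in> vecs X''" "nrm X'' z \<le> 1" and S: "finite S" "S \<subseteq> vecs X'" and e: "e > 0"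
  obtains y where "norm y < 1" "\<And>g. g \<in> S \<Longrightarrow> norm (g y - z g) < e"
proof -
  obtain \<iota> :: 'k where \<iota>: "\<iota> = 0 \<or> \<iota> * \<iota> = -1" "norm \<iota> \<le> 1"
      "\<And>c. c = of_real (re c) - of_real (re (\<iota> * c)) * \<iota>"
    using imaginary_unit[where 'k = 'k] by blast
  let ?T = "S \<union> scl X' \<iota> ` S"
  have "?T \<subseteq> vecs X'" using S(2) dual_scl by blast
  then obtain y where y: "norm y < 1" "\<And>g. g \<in> ?T \<Longrightarrow> \<bar>re (g y) - re (z g)\<bar> < e / 2"
    using Helly_real[OF z, of ?T "e/2"] S(1) e by auto
  show ?thesis
  proof (rule that[OF y(1)])
    fix g assume g: "g \<in> S"
    then have g': "g \<in> vecs X'" using S by blast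
    let ?c = "g y - z g"
    have "z (scl X' \<iota> g) = \<iota> * z g" using dualD(2)[OF z(1) g'] .
    then have "\<bar>re (\<iota> * ?c)\<bar> < e / 2"
      using y(2)[of "scl X' \<iota> g"] g by (simp add: scl_dual re_diff right_diff_distrib)
    moreover have "\<bar>re ?c\<bar> < e / 2" using y(2)[of g] g by (simp add: re_diff)
    moreover have "norm ?c \<le> \<bar>re ?c\<bar> + \<bar>re (\<iota> * ?c)\<bar>"
    proof -
      have "norm ?c = norm (of_real (re ?c) - of_real (re (\<iota> * ?c)) * \<iota>)"
        by (rule arg_cong[OF \<iota>(3)])
      also have "\<dots> \<le> norm (of_real (re ?c) :: 'k) + norm (of_real (re (\<iota> * ?c)) * \<iota>)" by (rule norm_triangle_ineq4)
      also have "\<dots> \<le> \<bar>re ?c\<bar> + \<bar>re (\<iota> * ?c)\<bar>" using \<iota>(2) by (simp add: norm_mult mult_left_le)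
      finally show ?thesis .
    qed
    ultimately show "norm ?c < e" by linarith
  qed
qed

text \<open>
  The closure is taken in the product topology, which induces the weak* topology on the bidual. A
  basic open set restricts finitely many coordinates, so this is Helly's theorem; coordinates outside
  the dual space vanish at \<open>z\<close> and at all points of the range.
\<close>

lemma Goldstine:
  assumes z: "z \<in> vecs X''" "nrm X'' z \<le> 1"
  shows "z \<in> closure (canonical_embedding (type_space sV) ` ball 0 1)"
  unfolding closure_iff_nhds_not_empty
proof (intro allI impI)
  fix A V assume "V \<subseteq> A" "open V" "z \<in> V"
  then obtain B where B: "z \<in> (\<Pi>\<^sub>E i\<in>UNIV. B i)" "\<And>i. open (B i)" "finite {i. B i \<noteq> UNIV}" "(\<Pi>\<^sub>E i\<in>UNIV. B i) \<subseteq> V"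
    using product_topology_open_contains_basis[of "\<lambda>i. euclidean" UNIV V z] unfolding open_fun_def by auto
  let ?S = "{g. B g \<noteq> UNIV}"
  have "\<exists>e>0. ball (z g) e \<subseteq> B g" for g
  proof -
    have "z g \<in> B g" using B(1) by (auto simp: PiE_def)
    then show ?thesis using openE[OF B(2)[of g]] by metis
  qed
  then obtain e where e: "\<And>g. e g > 0" "\<And>g. ball (z g) (e g) \<subseteq> B g" by metis
  define e0 where "e0 = Min (insert 1 (e ` ?S))"
  have e0: "e0 > 0" "\<And>g. g \<in> ?S \<Longrightarrow> e0 \<le> e g" using B(3) e(1) by (auto simp: e0_def)
  obtain y where y: "norm y < 1" "\<And>g. g \<in> ?S \<inter> vecs X' \<Longrightarrow> norm (g y - z g) < e0"
    using Helly[OF z, of "?S \<inter> vecs X'" e0] B(3) e0(1) by auto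
  have "canonical_embedding (type_space sV) y g \<in> B g" for g
  proof (cases "g \<in> ?S")
    case True
    show ?thesis
    proof (cases "g \<in> vecs X'")
      case in_dual: True
      then have "norm (g y - z g) < e g" using y(2) e0(2) True by fastforce
      then show ?thesis using e(2)[of g] in_dual
        by (auto simp: canonical_embedding_apply dist_norm norm_minus_commute)
    next
      case False
      then show ?thesis using e[of g] dualD(4)[OF z(1) False]
        by (auto simp: canonical_embedding_def)
    qed
  qed auto
  then have "canonical_embedding (type_space sV) y \<in> V" using B(4) by auto
  moreover have "canonical_embedding (type_space sV) y \<in> canonical_embedding (type_space sV) ` ball 0 1"
    using y(1) by (intro imageI) simp
  ultimately show "canonical_embedding (type_space sV) ` ball 0 1 \<inter> A \<noteq> {}"
    using \<open>V \<subseteq> A\<close> by blast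
qed

end


section \<open>Values of polynomials at a point of the bidual\<close>

text \<open>
  The functionals that norm a point of the bidual do so only up to a factor \<open>s < 1\<close>, which enters the
  estimates with a power. This lemma removes it.
\<close>

lemma le_of_power_mult_le:
  fixes b c :: real
  assumes "\<And>s. 0 < s \<Longrightarrow> s < 1 \<Longrightarrow> s ^ m * b \<le> c"
  shows "b \<le> c"
proof -
  have "((\<lambda>s. s ^ m * b) \<longlongrightarrow> 1 ^ m * b) (at_left 1)"
    by (intro tendsto_mult tendsto_power tendsto_ident_at tendsto_const)
  moreover have "\<forall>\<^sub>F s in at_left 1. s ^ m * b \<le> c"
    using assms by (auto simp: eventually_at_left_field intro!: exI[of _ 0])
  ultimately have "1 ^ m * b \<le> c" by (rule tendsto_upperbound) simp
  then show ?thesis by simp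
qed

lemma filter_to_closure_point:
  assumes "z \<in> closure (f ` S)"
  shows "inf (principal S) (filtercomap f (nhds z)) \<noteq> bot"
proof
  assume "inf (principal S) (filtercomap f (nhds z)) = bot"
  then have "eventually (\<lambda>x. x \<notin> S) (filtercomap f (nhds z))"
    unfolding trivial_limit_def inf.commute[of "principal S"] eventually_inf_principal by simp
  then obtain V where V: "open V" "z \<in> V" "\<And>x. f x \<in> V \<Longrightarrow> x \<notin> S"
    unfolding eventually_filtercomap eventually_nhds by blast
  then have "f ` S \<inter> V = {}" by blast
  then show False using assms V(1,2) open_Int_closure_eq_empty[of V "f ` S"] by blast
qed

lemma quotient_mapping_norm_le:
  assumes "quotient_mapping sE sF \<rho>"
  shows "norm (\<rho> x) \<le> norm x"
proof (rule field_le_epsilon)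
  interpret bounded_linear \<rho> using assms by (simp add: quotient_mapping_def)
  fix e :: real assume e: "e > 0"
  let ?r = "norm x + e"
  have r: "?r > 0" using e by (simp add: add_nonneg_pos)
  have "norm ((1 / ?r) *\<^sub>R x) < 1" using r e by simp
  then have "\<rho> ((1 / ?r) *\<^sub>R x) \<in> ball 0 1"
    using assms unfolding quotient_mapping_def by (metis dist_0_norm imageI mem_ball)
  then have "norm (\<rho> x) / ?r < 1" using r by (simp add: scaleR)
  then show "norm (\<rho> x) \<le> norm x + e" using r by (simp add: field_simps)
qed

text \<open>
  Along \<open>G\<close> the points \<open>\<rho> x\<close> tend weak* to \<open>z\<close>. No point of the bidual of \<open>E\<close> above \<open>z\<close> is chosen; the
  filter takes its place.
\<close>

locale bidual_limit = banach_pair sE sF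
  for sE :: "'k::real_or_complex \<Rightarrow> 'e::banach \<Rightarrow> 'e" and sF :: "'k \<Rightarrow> 'f::banach \<Rightarrow> 'f" +
  fixes \<rho> :: "'e \<Rightarrow> 'f" and z :: "('f \<Rightarrow> 'k) \<Rightarrow> 'k" and G :: "'e filter"
  assumes quotient: "quotient_mapping sE sF \<rho>"
    and z: "z \<in> vecs (dual (dual (type_space sF)))" "nrm (dual (dual (type_space sF))) z = 1"
    and G_nontrivial: "G \<noteq> bot"
    and G_ball: "\<forall>\<^sub>F x in G. norm x \<le> 1"
    and G_weak_star: "\<And>g. g \<in> vecs (dual (type_space sF)) \<Longrightarrow> ((\<lambda>x. g (\<rho> x)) \<longlongrightarrow> z g) G"
    and G_convergent: "\<And>k :: 'e \<Rightarrow> 'k. (\<exists>R. \<forall>x. norm x \<le> 1 \<longrightarrow> norm (k x) \<le> R) \<Longrightarrow> \<exists>l. (k \<longlongrightarrow> l) G"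

text \<open>
  A quotient mapping lifts the approximating points that Goldstine's theorem provides in the open
  unit ball of \<open>F\<close> to the open unit ball of \<open>E\<close>.
\<close>

lemma (in banach_pair) bidual_limit_exists:
  assumes quotient: "quotient_mapping sE sF \<rho>"
    and z: "z \<in> vecs (dual (dual (type_space sF)))" "nrm (dual (dual (type_space sF))) z = 1"
  obtains G where "bidual_limit sE sF \<rho> z G"
proof -
  let ?J = "canonical_embedding (type_space sF)"
  have "?J ` ball 0 1 = (\<lambda>x. ?J (\<rho> x)) ` ball 0 1"
    using quotient unfolding quotient_mapping_def by (metis image_image)
  then have "z \<in> closure ((\<lambda>x. ?J (\<rho> x)) ` ball 0 1)"
    using F.Goldstine[OF z(1)] z(2) by simp
  then have "inf (principal (ball 0 1)) (filtercomap (\<lambda>x. ?J (\<rho> x)) (nhds z)) \<noteq> bot" (is "?G0 \<noteq> bot")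
    by (rule filter_to_closure_point)
  then obtain G where G: "G \<noteq> bot" "G \<le> ?G0"
    "\<And>k :: 'e \<Rightarrow> 'k. (\<exists>R. \<forall>\<^sub>F x in ?G0. norm (k x) \<le> R) \<Longrightarrow> \<exists>l. (k \<longlongrightarrow> l) G"
    using convergent_subfilter[of ?G0, where 'k = 'k] by blast
  have ball: "\<forall>\<^sub>F x in ?G0. norm x \<le> 1"
    by (rule filter_leD[OF inf_le1]) (auto simp: eventually_principal)
  have lim: "filterlim (\<lambda>x. ?J (\<rho> x)) (nhds z) G"
    by (rule filterlim_mono[OF filterlim_filtercomap order_refl]) (rule order_trans[OF G(2) inf_le2])
  show thesis
  proof (rule \<open>\<And>G. bidual_limit sE sF \<rho> z G \<Longrightarrow> thesis\<close>, unfold_locales)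
    show "\<forall>\<^sub>F x in G. norm x \<le> 1" by (rule filter_leD[OF G(2) ball])
    show "((\<lambda>x. g (\<rho> x)) \<longlongrightarrow> z g) G" if g: "g \<in> vecs (dual (type_space sF))" for g
      using continuous_on_tendsto_compose[OF continuous_on_product_coordinates[of g] lim]
      by (simp add: canonical_embedding_def g)
    show "\<exists>l. (k \<longlongrightarrow> l) G" if "\<exists>R. \<forall>x. norm x \<le> 1 \<longrightarrow> norm (k x) \<le> R" for k :: "'e \<Rightarrow> 'k"
    proof (rule G(3))
      from that obtain R where "\<forall>x. norm x \<le> 1 \<longrightarrow> norm (k x) \<le> R" by blast
      then show "\<exists>R. \<forall>\<^sub>F x in ?G0. norm (k x) \<le> R"
        using ball by (intro exI[of _ R]) (auto elim: eventually_mono)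
    qed
  qed (fact quotient z G(1))+
qed

context bidual_limit
begin

text \<open>
  The weak* limit of \<open>P x\<close> along \<open>G\<close>: a substitute for the value of the Aron-Berner extension of \<open>P\<close> at a
  point of the bidual of \<open>E\<close>. That its norm is at most \<open>\<parallel>P\<parallel>\<close> is immediate from the definition.
\<close>

definition limit_value :: "('e \<Rightarrow> 'f) \<Rightarrow> ('f \<Rightarrow> 'k) \<Rightarrow> 'k" where
  "limit_value P = (\<lambda>g. if g \<in> vecs F.X' then Lim G (\<lambda>x. g (P x)) else 0)"

lemma norm_functional_poly_le:
  assumes "P \<in> vecs (poly_space sE sF n)" "g \<in> vecs F.X'" "norm x \<le> 1"
  shows "norm (g (P x)) \<le> nrm (poly_space sE sF n) P * nrm F.X' g"
proof -
  have "norm (g (P x)) \<le> nrm F.X' g * norm (P x)"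
    using norm_dual_apply_le[OF F.scaled_nspaces(1) assms(2), of "P x"] by simp
  also have "\<dots> \<le> nrm F.X' g * nrm (poly_space sE sF n) P"
    using norm_poly_le[OF assms(1,3)] nrm_dual_nonneg[OF F.scaled_nspaces(1) assms(2)]
    by (intro mult_left_mono)
  finally show ?thesis by (simp add: mult.commute)
qed

lemma tendsto_limit_value:
  assumes "P \<in> vecs (poly_space sE sF n)" "g \<in> vecs F.X'"
  shows "((\<lambda>x. g (P x)) \<longlongrightarrow> limit_value P g) G"
proof -
  obtain l where "((\<lambda>x. g (P x)) \<longlongrightarrow> l) G"
    using G_convergent[of "\<lambda>x. g (P x)"] norm_functional_poly_le[OF assms] by blast
  then show ?thesis using tendsto_Lim[OF G_nontrivial] by (metis assms(2) limit_value_def)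
qed

lemma limit_value_eqI:
  assumes "w \<in> vecs F.X''" "\<And>g. g \<in> vecs F.X' \<Longrightarrow> ((\<lambda>x. g (P x)) \<longlongrightarrow> w g) G"
  shows "limit_value P = w"
proof
  fix g
  show "limit_value P g = w g"
    using tendsto_Lim[OF G_nontrivial assms(2)] dualD(4)[OF assms(1)] by (simp add: limit_value_def)
qed

lemma limit_value_in_bidual:
  assumes P: "P \<in> vecs (poly_space sE sF n)"
  shows "limit_value P \<in> vecs F.X''" and "nrm F.X'' (limit_value P) \<le> nrm (poly_space sE sF n) P"
proof -
  have bound: "norm (limit_value P g) \<le> nrm (poly_space sE sF n) P * nrm F.X' g" if "g \<in> vecs F.X'" for g
  proof (rule Lim_norm_ubound[OF G_nontrivial tendsto_limit_value[OF P that]])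
    show "\<forall>\<^sub>F x in G. norm (g (P x)) \<le> nrm (poly_space sE sF n) P * nrm F.X' g"
      using G_ball by eventually_elim (rule norm_functional_poly_le[OF P that])
  qed
  show "limit_value P \<in> vecs F.X''"
  proof (rule dualI[OF _ _ bound])
    fix g h assume g: "g \<in> vecs F.X'" and h: "h \<in> vecs F.X'"
    have "((\<lambda>x. g (P x) + h (P x)) \<longlongrightarrow> limit_value P g + limit_value P h) G"
      by (intro tendsto_add tendsto_limit_value[OF P] g h)
    then show "limit_value P (g + h) = limit_value P g + limit_value P h"
      using tendsto_unique[OF G_nontrivial tendsto_limit_value[OF P dual_add[OF g h]]] by simp
  next
    fix c g assume g: "g \<in> vecs F.X'"
    have "((\<lambda>x. c * g (P x)) \<longlongrightarrow> c * limit_value P g) G"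
      by (intro tendsto_mult tendsto_const tendsto_limit_value[OF P] g)
    then show "limit_value P (scl F.X' c g) = c * limit_value P g"
      using tendsto_unique[OF G_nontrivial tendsto_limit_value[OF P dual_scl[OF g]]] by (simp add: scl_dual)
  qed (simp_all add: limit_value_def)
  show "nrm F.X'' (limit_value P) \<le> nrm (poly_space sE sF n) P"
    using bound scaled_nspaceD(3)[OF scaled_nspace_poly P]
    by (intro nrm_dual_le_bound F.scaled_nspaces)
qed

lemma limit_value_add:
  assumes P: "P \<in> vecs (poly_space sE sF n)" and Q: "Q \<in> vecs (poly_space sE sF n)"
  shows "limit_value (P + Q) = limit_value P + limit_value Q"
proof (rule limit_value_eqI)
  show "limit_value P + limit_value Q \<in> vecs F.X''" by (intro dual_add limit_value_in_bidual[OF P] limit_value_in_bidual[OF Q])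
  fix g assume g: "g \<in> vecs F.X'"
  have "((\<lambda>x. g (P x) + g (Q x)) \<longlongrightarrow> limit_value P g + limit_value Q g) G"
    by (intro tendsto_add tendsto_limit_value[OF P g] tendsto_limit_value[OF Q g])
  then show "((\<lambda>x. g ((P + Q) x)) \<longlongrightarrow> (limit_value P + limit_value Q) g) G"
    using dualD(1)[OF g] by simp
qed

lemma limit_value_scale:
  assumes P: "P \<in> vecs (poly_space sE sF n)"
  shows "limit_value (scl (poly_space sE sF n) c P) = scl F.X'' c (limit_value P)"
proof (rule limit_value_eqI)
  show "scl F.X'' c (limit_value P) \<in> vecs F.X''" by (intro dual_scl limit_value_in_bidual[OF P])
  fix g assume g: "g \<in> vecs F.X'"
  have "((\<lambda>x. c * g (P x)) \<longlongrightarrow> c * limit_value P g) G"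
    by (intro tendsto_mult tendsto_const tendsto_limit_value[OF P g])
  then show "((\<lambda>x. g (scl (poly_space sE sF n) c P x)) \<longlongrightarrow> scl F.X'' c (limit_value P) g) G"
    using dualD(2)[OF g] by (simp add: scl_dual poly_space_simps(2))
qed

text \<open>
  On the dual of \<open>E\<close> the filter \<open>G\<close> converges, so it is weakly Cauchy and \<open>P x\<close> converges in norm.
\<close>

lemma limit_value_wpoly:
  assumes "P \<in> wpoly_subspace sE sF n"
  obtains l where "limit_value P = canonical_embedding (type_space sF) l"
proof -
  have P: "fdegree_le n P" "weakly_continuous_on_bounded sE P"
    using assms homogeneous_polynomial_fdegree_le by (auto simp: wpoly_subspace_def poly_space_simps)
  have "\<exists>l. (k \<longlongrightarrow> l) G" if k: "k \<in> vecs (dual (type_space sE))" for k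
  proof (rule G_convergent)
    have "norm (k x) \<le> nrm (dual (type_space sE)) k" if "norm x \<le> 1" for x
      using norm_dual_apply_le[OF E.scaled_nspaces(1) k, of x] that
        nrm_dual_nonneg[OF E.scaled_nspaces(1) k] mult_left_le[of "norm x" "nrm (dual (type_space sE)) k"] by simp
    then show "\<exists>R. \<forall>x. norm x \<le> 1 \<longrightarrow> norm (k x) \<le> R" by blast
  qed
  then obtain l where l: "(P \<longlongrightarrow> l) G"
    using weakly_Cauchy_imp_convergent[OF P G_ball] by blast
  have "limit_value P = canonical_embedding (type_space sF) l"
  proof (rule limit_value_eqI[OF F.canonical_embedding_in_bidual])
    fix g assume g: "g \<in> vecs F.X'"
    show "((\<lambda>x. g (P x)) \<longlongrightarrow> canonical_embedding (type_space sF) l g) G"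
      using bounded_linear.tendsto[OF F.bounded_linear_dual[OF g] l] by (simp add: canonical_embedding_def g)
  qed
  then show ?thesis by (rule that)
qed

lemma functional_circ_quotient:
  assumes "g \<in> vecs F.X'"
  shows "(\<lambda>x. g (\<rho> x)) \<in> vecs (dual (type_space sE))"
proof (rule dualI[where B = "nrm F.X' g"])
  have lin: "Vector_Spaces.linear sE sF \<rho>" using quotient by (simp add: quotient_mapping_def)
  show "g (\<rho> (x + y)) = g (\<rho> x) + g (\<rho> y)" for x y
    using lin dualD(1)[OF assms] by (simp add: Vector_Spaces.linear_iff)
  show "g (\<rho> (scl (type_space sE) c x)) = c * g (\<rho> x)" for c x
    using lin dualD(2)[OF assms] by (simp add: Vector_Spaces.linear_iff)
  fix x
  have "norm (g (\<rho> x)) \<le> nrm F.X' g * norm (\<rho> x)"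
    using norm_dual_apply_le[OF F.scaled_nspaces(1) assms, of "\<rho> x"] by simp
  also have "\<dots> \<le> nrm F.X' g * norm x"
    using quotient_mapping_norm_le[OF quotient] nrm_dual_nonneg[OF F.scaled_nspaces(1) assms]
    by (intro mult_left_mono)
  finally show "norm (g (\<rho> x)) \<le> nrm F.X' g * nrm (type_space sE) x" by simp
qed simp

text \<open>
  For \<open>\<bar>z g\<bar>\<close> close to \<open>1\<close> the limit value is \<open>z\<close> up to an almost unimodular factor, while the
  polynomial has norm at most \<open>\<parallel>g\<parallel> ^ m\<close>. This makes \<open>z\<close> visible to functionals on the space of polynomials.
\<close>

lemma limit_value_power_times_quotient:
  assumes g: "g \<in> vecs F.X'"
  shows "limit_value (\<lambda>x. sF (g (\<rho> x) ^ m) (\<rho> x)) = scl F.X'' (z g ^ m) z"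
proof (rule limit_value_eqI)
  show "scl F.X'' (z g ^ m) z \<in> vecs F.X''" by (intro dual_scl z)
  fix h assume h: "h \<in> vecs F.X'"
  have "((\<lambda>x. g (\<rho> x) ^ m * h (\<rho> x)) \<longlongrightarrow> z g ^ m * z h) G"
    by (intro tendsto_mult tendsto_power G_weak_star g h)
  then show "((\<lambda>x. h (sF (g (\<rho> x) ^ m) (\<rho> x))) \<longlongrightarrow> scl F.X'' (z g ^ m) z h) G"
    using dualD(2)[OF h] by (simp add: scl_dual)
qed

lemma limit_value_power_times_vector:
  assumes g: "g \<in> vecs F.X'"
  shows "limit_value (\<lambda>x. sF (g (\<rho> x) ^ m) (sF (g (\<rho> x)) y)) =
    scl F.X'' (z g ^ Suc m) (canonical_embedding (type_space sF) y)"
proof (rule limit_value_eqI)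
  show "scl F.X'' (z g ^ Suc m) (canonical_embedding (type_space sF) y) \<in> vecs F.X''"
    by (intro dual_scl F.canonical_embedding_in_bidual)
  fix h assume h: "h \<in> vecs F.X'"
  have h': "h (sF c w) = c * h w" for c w using dualD(2)[OF h, of w c] by simp
  have "((\<lambda>x. g (\<rho> x) ^ m * (g (\<rho> x) * h y)) \<longlongrightarrow> z g ^ m * (z g * h y)) G"
    by (intro tendsto_mult tendsto_power G_weak_star g tendsto_const)
  then show "((\<lambda>x. h (sF (g (\<rho> x) ^ m) (sF (g (\<rho> x)) y))) \<longlongrightarrow>
      scl F.X'' (z g ^ Suc m) (canonical_embedding (type_space sF) y) h) G"
    by (simp only: h' scl_dual F.canonical_embedding_apply[OF h] power_Suc2 mult.assoc)
qed

text \<open>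
  The functional is \<open>0\<close> off the carrier, as the encoding of dual spaces demands.
\<close>

definition lift_functional :: "nat \<Rightarrow> ((('f \<Rightarrow> 'k) \<Rightarrow> 'k) \<Rightarrow> 'k) \<Rightarrow> ('e \<Rightarrow> 'f) \<Rightarrow> 'k" where
  "lift_functional n \<psi> P = (if P \<in> vecs (poly_space sE sF n) then \<psi> (limit_value P) else 0)"

lemma lift_functional_in_dual:
  assumes \<psi>: "\<psi> \<in> vecs (dual F.X'')"
  shows "lift_functional n \<psi> \<in> vecs (dual (poly_space sE sF n))"
    and "nrm (dual (poly_space sE sF n)) (lift_functional n \<psi>) \<le> nrm (dual F.X'') \<psi>"
proof -
  let ?P = "poly_space sE sF n"
  have nonneg: "0 \<le> nrm (dual F.X'') \<psi>" by (rule nrm_dual_nonneg[OF F.scaled_nspaces(3) \<psi>])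
  have bound: "norm (lift_functional n \<psi> P) \<le> nrm (dual F.X'') \<psi> * nrm ?P P" if P: "P \<in> vecs ?P" for P
  proof -
    have "norm (\<psi> (limit_value P)) \<le> nrm (dual F.X'') \<psi> * nrm F.X'' (limit_value P)"
      by (rule norm_dual_apply_le[OF F.scaled_nspaces(3) \<psi> limit_value_in_bidual(1)[OF P]])
    also have "\<dots> \<le> nrm (dual F.X'') \<psi> * nrm ?P P"
      using limit_value_in_bidual(2)[OF P] nonneg by (intro mult_left_mono)
    finally show ?thesis by (simp add: lift_functional_def P)
  qed
  show "lift_functional n \<psi> \<in> vecs (dual ?P)"
  proof (rule dualI[OF _ _ bound])
    fix P Q assume P: "P \<in> vecs ?P" and Q: "Q \<in> vecs ?P"
    show "lift_functional n \<psi> (P + Q) = lift_functional n \<psi> P + lift_functional n \<psi> Q"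
      using dualD(1)[OF \<psi> limit_value_in_bidual(1)[OF P] limit_value_in_bidual(1)[OF Q]]
      by (simp add: lift_functional_def P Q poly_add limit_value_add[OF P Q])
  next
    fix c P assume P: "P \<in> vecs ?P"
    show "lift_functional n \<psi> (scl ?P c P) = c * lift_functional n \<psi> P"
      using dualD(2)[OF \<psi> limit_value_in_bidual(1)[OF P]] scaled_nspaceD(1)[OF scaled_nspace_poly P]
      by (simp add: lift_functional_def P limit_value_scale[OF P])
  qed (simp_all add: lift_functional_def)
  show "nrm (dual ?P) (lift_functional n \<psi>) \<le> nrm (dual F.X'') \<psi>"
    by (rule nrm_dual_le_bound[OF scaled_nspace_poly nonneg bound])
qed

end

section \<open>The canonical projection\<close>

context banach_over
begin

definition restriction :: "((('v \<Rightarrow> 'k) \<Rightarrow> 'k) \<Rightarrow> 'k) \<Rightarrow> 'v \<Rightarrow> 'k" where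
  "restriction \<psi> = (\<lambda>y. \<psi> (canonical_embedding (type_space sV) y))"

text \<open>
  The adjoint of the embedding of \<open>X\<close> into its bidual, followed by the canonical embedding of the dual
  of \<open>X\<close> into its own bidual.
\<close>

definition canonical_projection :: "((('v \<Rightarrow> 'k) \<Rightarrow> 'k) \<Rightarrow> 'k) \<Rightarrow> (('v \<Rightarrow> 'k) \<Rightarrow> 'k) \<Rightarrow> 'k" where
  "canonical_projection \<psi> = (\<lambda>z. if z \<in> vecs X'' then z (restriction \<psi>) else 0)"

lemma restriction_in_dual:
  assumes \<psi>: "\<psi> \<in> vecs (dual X'')"
  shows "restriction \<psi> \<in> vecs X'" and "nrm X' (restriction \<psi>) \<le> nrm (dual X'') \<psi>"
proof -
  have nonneg: "0 \<le> nrm (dual X'') \<psi>" by (rule nrm_dual_nonneg[OF scaled_nspaces(3) \<psi>])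
  have bound: "norm (restriction \<psi> x) \<le> nrm (dual X'') \<psi> * nrm (type_space sV) x" for x
  proof -
    have "norm (\<psi> (canonical_embedding (type_space sV) x)) \<le>
        nrm (dual X'') \<psi> * nrm X'' (canonical_embedding (type_space sV) x)"
      by (rule norm_dual_apply_le[OF scaled_nspaces(3) \<psi> canonical_embedding_in_bidual])
    also have "\<dots> \<le> nrm (dual X'') \<psi> * norm x"
    proof (intro mult_left_mono nonneg nrm_dual_le_bound[OF scaled_nspaces(2)])
      fix g assume g: "g \<in> vecs X'"
      show "norm (canonical_embedding (type_space sV) x g) \<le> norm x * nrm X' g"
        using norm_dual_apply_le[OF scaled_nspaces(1) g, of x]
        by (simp add: canonical_embedding_apply[OF g] mult.commute)
    qed simp
    finally show ?thesis by (simp add: restriction_def)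
  qed
  show "restriction \<psi> \<in> vecs X'"
  proof (rule dualI[OF _ _ bound])
    show "restriction \<psi> (x + y) = restriction \<psi> x + restriction \<psi> y" for x y
      using dualD(1)[OF \<psi> canonical_embedding_in_bidual canonical_embedding_in_bidual]
      by (simp add: restriction_def canonical_embedding_add)
    show "restriction \<psi> (scl (type_space sV) c x) = c * restriction \<psi> x" for c x
      using dualD(2)[OF \<psi> canonical_embedding_in_bidual]
      by (simp add: restriction_def canonical_embedding_scale)
  qed simp
  show "nrm X' (restriction \<psi>) \<le> nrm (dual X'') \<psi>"
    by (rule nrm_dual_le_bound[OF scaled_nspaces(1) nonneg bound])
qed

lemma canonical_projection_in_dual:
  assumes \<psi>: "\<psi> \<in> vecs (dual X'')"
  shows "canonical_projection \<psi> \<in> vecs (dual X'')"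
    and "nrm (dual X'') (canonical_projection \<psi>) \<le> nrm X' (restriction \<psi>)"
proof -
  note r = restriction_in_dual(1)[OF \<psi>]
  have bound: "norm (canonical_projection \<psi> z) \<le> nrm X' (restriction \<psi>) * nrm X'' z" if "z \<in> vecs X''" for z
    using norm_dual_apply_le[OF scaled_nspaces(2) that r] that
    by (simp add: canonical_projection_def mult.commute)
  show "canonical_projection \<psi> \<in> vecs (dual X'')"
    by (intro dualI[OF _ _ bound])
      (auto simp: canonical_projection_def dual_add scl_dual dual_scl[unfolded scl_dual])
  show "nrm (dual X'') (canonical_projection \<psi>) \<le> nrm X' (restriction \<psi>)"
    by (rule nrm_dual_le_bound[OF scaled_nspaces(3) nrm_dual_nonneg[OF scaled_nspaces(1) r] bound])
qed

lemma restriction_canonical_projection: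
  assumes "\<psi> \<in> vecs (dual X'')"
  shows "restriction (canonical_projection \<psi>) = restriction \<psi>"
  using restriction_in_dual(1)[OF assms] canonical_embedding_in_bidual
  by (auto simp: restriction_def canonical_projection_def canonical_embedding_apply)

end

section \<open>The inequality for the canonical projection\<close>

text \<open>
  The functional \<open>\<Phi>0\<close> is fixed by \<open>q\<close>: it coincides with \<open>q \<Phi>0\<close> on the weakly continuous polynomials,
  and its restriction to them already has the norm \<open>\<parallel>\<psi> \<circ> J\<parallel>\<close>, so that \<open>\<parallel>\<Phi>0\<parallel> \<le> \<parallel>q \<Phi>0\<parallel>\<close> and the inequality for \<open>q\<close> leaves
  no room for \<open>\<Phi>0 - q \<Phi>0\<close>.
\<close>

lemma (in banach_pair) M1_inequality_at_unit_vector: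
  assumes M1: "M1_ideal C (poly_space sE sF (Suc m)) (wpoly_subspace sE sF (Suc m))"
    and quotient: "quotient_mapping sE sF \<rho>" and C: "0 < C"
    and \<psi>: "\<psi> \<in> vecs (dual F.X'')"
    and z: "z \<in> vecs F.X''" "nrm F.X'' z = 1"
  shows "nrm F.X' (F.restriction \<psi>) + C * norm (\<psi> z - F.canonical_projection \<psi> z) \<le> nrm (dual F.X'') \<psi>"
proof -
  obtain G where "bidual_limit sE sF \<rho> z G" using bidual_limit_exists[OF quotient z] .
  then interpret bidual_limit sE sF \<rho> z G .
  let ?P = "poly_space sE sF (Suc m)" and ?W = "wpoly_subspace sE sF (Suc m)"
  let ?D = "dual (poly_space sE sF (Suc m))"
  obtain q where q: "ideal_projection ?P ?W q"
    and ineq: "\<And>\<phi>. \<phi> \<in> vecs ?D \<Longrightarrow> nrm ?D (q \<phi>) + C * nrm ?D (\<phi> - q \<phi>) \<le> nrm ?D \<phi>"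
    using M1 unfolding M1_ideal_def by blast
  have q_in: "q \<phi> \<in> vecs ?D" if "\<phi> \<in> vecs ?D" for \<phi>
    using q that unfolding ideal_projection_def by blast
  have q_add: "q (\<phi> + \<eta>) = q \<phi> + q \<eta>" if "\<phi> \<in> vecs ?D" "\<eta> \<in> vecs ?D" for \<phi> \<eta>
    using q that unfolding ideal_projection_def by blast
  have q_diff: "q (\<phi> - \<eta>) = q \<phi> - q \<eta>" if "\<phi> \<in> vecs ?D" "\<eta> \<in> vecs ?D" for \<phi> \<eta>
    using q_add[OF dual_diff[OF that] that(2)] by (simp add: algebra_simps)
  have q_idem: "q (q \<phi>) = q \<phi>" if "\<phi> \<in> vecs ?D" for \<phi>
    using q that unfolding ideal_projection_def by blast
  have q_kernel: "q \<phi> = 0 \<longleftrightarrow> (\<forall>P\<in>?W. \<phi> P = 0)" if "\<phi> \<in> vecs ?D" for \<phi>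
    using q that unfolding ideal_projection_def annihilator_def by blast
  let ?\<pi> = "F.canonical_projection \<psi>" and ?\<psi>F = "F.restriction \<psi>"
  note \<pi> = F.canonical_projection_in_dual[OF \<psi>]
  define \<Phi> where "\<Phi> = lift_functional (Suc m) \<psi>"
  define \<Phi>0 where "\<Phi>0 = lift_functional (Suc m) ?\<pi>"
  have \<Phi>: "\<Phi> \<in> vecs ?D" "nrm ?D \<Phi> \<le> nrm (dual F.X'') \<psi>"
    unfolding \<Phi>_def by (rule lift_functional_in_dual[OF \<psi>])+
  have \<Phi>0: "\<Phi>0 \<in> vecs ?D" "nrm ?D \<Phi>0 \<le> nrm F.X' ?\<psi>F"
    unfolding \<Phi>0_def using lift_functional_in_dual[OF \<pi>(1)] \<pi>(2) order_trans by blast+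
  have "\<Phi> P = \<Phi>0 P" if P: "P \<in> ?W" for P
  proof -
    obtain l where l: "limit_value P = canonical_embedding (type_space sF) l" using limit_value_wpoly[OF P] .
    have "\<psi> (limit_value P) = ?\<pi> (limit_value P)"
      using F.restriction_canonical_projection[OF \<psi>] unfolding l F.restriction_def by (metis)
    then show ?thesis by (simp add: \<Phi>_def \<Phi>0_def lift_functional_def)
  qed
  then have "q (\<Phi> - \<Phi>0) = 0"
    using q_kernel[OF dual_diff[OF \<Phi>(1) \<Phi>0(1)]] by simp
  then have q_eq: "q \<Phi> = q \<Phi>0" by (simp add: q_diff \<Phi>(1) \<Phi>0(1))
  have almost: "\<exists>g\<in>vecs F.X'. nrm F.X' g \<le> 1 \<and> s < norm (z g)" if "s < 1" for s
  proof (rule ccontr)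
    assume "\<not> ?thesis"
    then have "nrm F.X'' z \<le> s" by (intro nrm_dual_le[OF F.scaled_nspaces(2)]) (auto simp: not_less)
    then show False using z(2) that by simp
  qed
  \<comment> \<open>Rank-one polynomials see the whole norm of the restriction of \<open>\<psi>\<close>, and \<open>\<Phi>0\<close> agrees with \<open>q \<Phi>0\<close> on them.\<close>
  have norm_q: "nrm F.X' ?\<psi>F \<le> nrm ?D (q \<Phi>0)"
  proof (rule nrm_dual_le[OF F.scaled_nspaces(1)])
    fix y assume "nrm (type_space sF) y \<le> 1"
    then have y: "norm y \<le> 1" by simp
    show "norm (?\<psi>F y) \<le> nrm ?D (q \<Phi>0)"
    proof (rule le_of_power_mult_le[of "Suc m"])
      fix s :: real assume s: "0 < s" "s < 1"
      then obtain g where g: "g \<in> vecs F.X'" "nrm F.X' g \<le> 1" "s < norm (z g)" using almost by blast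
      define S where "S = (\<lambda>x. sF (g (\<rho> x) ^ m) (sF (g (\<rho> x)) y))"
      have SW: "S \<in> ?W"
        unfolding S_def by (rule finite_type_polynomial_weakly_continuous[OF functional_circ_quotient[OF g(1)]])
      then have SP: "S \<in> vecs ?P" by (simp add: wpoly_subspace_def)
      have g_le: "norm (g (\<rho> x)) \<le> 1" if "norm x \<le> 1" for x
      proof -
        have "norm (g (\<rho> x)) \<le> nrm F.X' g * norm (\<rho> x)"
          using norm_dual_apply_le[OF F.scaled_nspaces(1) g(1), of "\<rho> x"] by simp
        also have "\<dots> \<le> 1 * 1"
          using g(2) quotient_mapping_norm_le[OF quotient, of x] that by (intro mult_mono) auto
        finally show ?thesis by simp
      qed
      have "nrm ?P S \<le> 1"
      proof (rule nrm_poly_le)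
        fix x :: 'e assume "norm x \<le> 1"
        then have "norm (g (\<rho> x)) ^ m * (norm (g (\<rho> x)) * norm y) \<le> 1 * (1 * 1)"
          using g_le y by (intro mult_mono power_le_one) auto
        then show "norm (S x) \<le> 1" by (simp add: S_def F.norm_scale norm_power norm_mult mult.assoc)
      qed
      have "\<Phi>0 S - q \<Phi>0 S = 0"
      proof -
        have "q (\<Phi>0 - q \<Phi>0) = 0" using q_diff[OF \<Phi>0(1) q_in[OF \<Phi>0(1)]] q_idem[OF \<Phi>0(1)] by simp
        then show ?thesis using q_kernel[OF dual_diff[OF \<Phi>0(1) q_in[OF \<Phi>0(1)]]] SW by simp
      qed
      moreover have "\<Phi>0 S = z g ^ Suc m * ?\<psi>F y"
      proof -
        have "\<Phi>0 S = ?\<pi> (scl F.X'' (z g ^ Suc m) (canonical_embedding (type_space sF) y))"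
          unfolding \<Phi>0_def lift_functional_def using SP limit_value_power_times_vector[OF g(1), of m y] by (simp add: S_def)
        also have "\<dots> = z g ^ Suc m * ?\<pi> (canonical_embedding (type_space sF) y)"
          by (rule dualD(2)[OF \<pi>(1) F.canonical_embedding_in_bidual])
        also have "?\<pi> (canonical_embedding (type_space sF) y) = ?\<psi>F y"
          using F.restriction_canonical_projection[OF \<psi>] by (metis F.restriction_def)
        finally show ?thesis .
      qed
      ultimately have "q \<Phi>0 S = z g ^ Suc m * ?\<psi>F y" by simp
      then have "norm (z g) ^ Suc m * norm (?\<psi>F y) = norm (q \<Phi>0 S)"
        by (simp only: norm_mult norm_power)
      also have "\<dots> \<le> nrm ?D (q \<Phi>0) * nrm ?P S"
        by (rule norm_dual_apply_le[OF scaled_nspace_poly q_in[OF \<Phi>0(1)] SP])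
      also have "\<dots> \<le> nrm ?D (q \<Phi>0)"
        using \<open>nrm ?P S \<le> 1\<close> nrm_dual_nonneg[OF scaled_nspace_poly q_in[OF \<Phi>0(1)]] by (simp add: mult_left_le)
      finally show "s ^ Suc m * norm (?\<psi>F y) \<le> nrm ?D (q \<Phi>0)"
        using power_mono[of s "norm (z g)" "Suc m"] g(3) s(1) mult_right_mono[of "s ^ Suc m" "norm (z g) ^ Suc m" "norm (?\<psi>F y)"]
        by (meson less_imp_le norm_ge_zero order_trans)
    qed
  qed
  have "q \<Phi>0 = \<Phi>0"
  proof -
    have "C * nrm ?D (\<Phi>0 - q \<Phi>0) \<le> 0" using ineq[OF \<Phi>0(1)] norm_q \<Phi>0(2) by simp
    then have "nrm ?D (\<Phi>0 - q \<Phi>0) \<le> 0" using C by (simp add: mult_le_0_iff)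
    then have "\<Phi>0 - q \<Phi>0 = 0" by (rule nrm_dual_eq_0[OF scaled_nspace_poly dual_diff[OF \<Phi>0(1) q_in[OF \<Phi>0(1)]]])
    then show ?thesis by simp
  qed
  then have main: "nrm ?D \<Phi>0 + C * nrm ?D (\<Phi> - \<Phi>0) \<le> nrm (dual F.X'') \<psi>"
    using ineq[OF \<Phi>(1)] q_eq \<Phi>(2) by simp
  \<comment> \<open>Tested with the polynomials \<open>x \<mapsto> g (\<rho> x) ^ m \<cdot> \<rho> x\<close> of norm at most \<open>1\<close>.\<close>
  have diff: "norm (\<psi> z - ?\<pi> z) \<le> nrm ?D (\<Phi> - \<Phi>0)"
  proof (rule le_of_power_mult_le[of m])
    fix s :: real assume s: "0 < s" "s < 1"
    then obtain g where g: "g \<in> vecs F.X'" "nrm F.X' g \<le> 1" "s < norm (z g)" using almost by blast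
    define T where "T = (\<lambda>x. sF (g (\<rho> x) ^ m) (\<rho> x))"
    have TP: "T \<in> vecs ?P" unfolding T_def
      using quotient by (intro functional_power_times_operator[OF functional_circ_quotient[OF g(1)]])
        (auto simp: quotient_mapping_def intro: linear_continuous_on)
    have "nrm ?P T \<le> 1"
    proof (rule nrm_poly_le)
      fix x :: 'e assume x: "norm x \<le> 1"
      have \<rho>x: "norm (\<rho> x) \<le> 1" using quotient_mapping_norm_le[OF quotient, of x] x by simp
      have "norm (g (\<rho> x)) \<le> nrm F.X' g * norm (\<rho> x)"
        using norm_dual_apply_le[OF F.scaled_nspaces(1) g(1), of "\<rho> x"] by simp
      also have "\<dots> \<le> 1 * 1" using g(2) \<rho>x by (intro mult_mono) auto
      finally have "norm (g (\<rho> x)) ^ m * norm (\<rho> x) \<le> 1 * 1"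
        using \<rho>x by (intro mult_mono power_le_one) auto
      then show "norm (T x) \<le> 1" by (simp add: T_def F.norm_scale norm_power)
    qed
    have "(\<Phi> - \<Phi>0) T = z g ^ m * (\<psi> z - ?\<pi> z)"
      using limit_value_power_times_quotient[OF g(1), of m] TP dualD(2)[OF \<psi> z(1)] dualD(2)[OF \<pi>(1) z(1)]
      by (simp add: \<Phi>_def \<Phi>0_def lift_functional_def T_def[symmetric] right_diff_distrib)
    then have "norm (z g) ^ m * norm (\<psi> z - ?\<pi> z) = norm ((\<Phi> - \<Phi>0) T)"
      by (simp add: norm_mult norm_power)
    also have "\<dots> \<le> nrm ?D (\<Phi> - \<Phi>0) * nrm ?P T"
      by (rule norm_dual_apply_le[OF scaled_nspace_poly dual_diff[OF \<Phi>(1) \<Phi>0(1)] TP])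
    also have "\<dots> \<le> nrm ?D (\<Phi> - \<Phi>0)"
      using \<open>nrm ?P T \<le> 1\<close> nrm_dual_nonneg[OF scaled_nspace_poly dual_diff[OF \<Phi>(1) \<Phi>0(1)]] by (simp add: mult_left_le)
    finally show "s ^ m * norm (\<psi> z - ?\<pi> z) \<le> nrm ?D (\<Phi> - \<Phi>0)"
      using power_mono[of s "norm (z g)" m] g(3) s(1) mult_right_mono[of "s ^ m" "norm (z g) ^ m" "norm (\<psi> z - ?\<pi> z)"]
      by (meson less_imp_le norm_ge_zero order_trans)
  qed
  have "nrm F.X' ?\<psi>F \<le> nrm ?D \<Phi>0" using norm_q \<open>q \<Phi>0 = \<Phi>0\<close> by simp
  moreover have "C * norm (\<psi> z - ?\<pi> z) \<le> C * nrm ?D (\<Phi> - \<Phi>0)"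
    using diff C by (intro mult_left_mono) auto
  ultimately show ?thesis using main by linarith
qed

theorem proposition4p6:
  fixes sE :: "'k::real_or_complex \<Rightarrow> 'e::banach \<Rightarrow> 'e"
    and sF :: "'k \<Rightarrow> 'f::banach \<Rightarrow> 'f"
    and n :: nat and C :: real
  assumes "banach_over sE" and "banach_over sF"
    and "\<exists>\<rho>. quotient_mapping sE sF \<rho>"
    and "n \<ge> 1" and "0 < C" and "C \<le> 1"
    and "M1_ideal C (poly_space sE sF n) (wpoly_subspace sE sF n)"
  shows "M1_ideal C (dual (dual (type_space sF))) (range (canonical_embedding (type_space sF)))"
proof -
  interpret banach_pair sE sF using assms(1,2) by (simp add: banach_pair_def)
  obtain \<rho> where \<rho>: "quotient_mapping sE sF \<rho>" using assms(3) ..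
  obtain m where n: "n = Suc m" using assms(4) by (cases n) auto
  let ?q = "F.canonical_projection" and ?J = "canonical_embedding (type_space sF)"
  note M1 = assms(7)[unfolded n]
  have ineq: "nrm (dual F.X'') (?q \<psi>) + C * nrm (dual F.X'') (\<psi> - ?q \<psi>) \<le> nrm (dual F.X'') \<psi>"
    if \<psi>: "\<psi> \<in> vecs (dual F.X'')" for \<psi>
  proof -
    note q = F.canonical_projection_in_dual[OF \<psi>]
    let ?b = "(nrm (dual F.X'') \<psi> - nrm F.X' (F.restriction \<psi>)) / C"
    \<comment> \<open>The inequality at unit vectors extends to the unit ball by scaling; at \<open>z = 0\<close> it reads \<open>0 \<le> ?b\<close>.\<close>
    have "nrm (dual F.X'') (\<psi> - ?q \<psi>) \<le> ?b"
    proof (rule nrm_dual_le[OF F.scaled_nspaces(3)])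
      fix z assume z: "z \<in> vecs F.X''" "nrm F.X'' z \<le> 1"
      show "norm ((\<psi> - ?q \<psi>) z) \<le> ?b"
      proof (cases "nrm F.X'' z = 0")
        case True
        then have "z = 0" using nrm_dual_eq_0[OF F.scaled_nspaces(2) z(1)] by simp
        then have "(\<psi> - ?q \<psi>) z = 0"
          using dualD(1)[OF dual_diff[OF \<psi> q(1)], of 0 0] dual_zero[of F.X'] by simp
        then show ?thesis using F.restriction_in_dual(2)[OF \<psi>] assms(5) by simp
      next
        case False
        then have pos: "nrm F.X'' z > 0" using scaled_nspaceD(3)[OF F.scaled_nspaces(3) z(1)] by simp
        define c :: 'k where "c = of_real (inverse (nrm F.X'' z))"
        have c: "norm c = inverse (nrm F.X'' z)" using pos by (simp add: c_def norm_inverse)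
        have w: "scl F.X'' c z \<in> vecs F.X''" "nrm F.X'' (scl F.X'' c z) = 1"
          using scaled_nspaceD(1,2)[OF F.scaled_nspaces(3) z(1), of c] pos c by simp_all
        have "nrm F.X' (F.restriction \<psi>) + C * norm (\<psi> (scl F.X'' c z) - ?q \<psi> (scl F.X'' c z)) \<le> nrm (dual F.X'') \<psi>"
          by (rule M1_inequality_at_unit_vector[OF M1 \<rho> assms(5) \<psi> w])
        then have "norm (\<psi> (scl F.X'' c z) - ?q \<psi> (scl F.X'' c z)) \<le> ?b"
          using assms(5) by (simp add: field_simps)
        moreover have "\<psi> (scl F.X'' c z) - ?q \<psi> (scl F.X'' c z) = c * (\<psi> - ?q \<psi>) z"
          using dualD(2)[OF dual_diff[OF \<psi> q(1)] z(1), of c] by simp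
        moreover have "1 * norm ((\<psi> - ?q \<psi>) z) \<le> norm c * norm ((\<psi> - ?q \<psi>) z)"
          using pos z(2) c by (intro mult_right_mono) (auto simp: one_le_inverse)
        ultimately show ?thesis by (simp add: norm_mult)
      qed
    qed
    then have "C * nrm (dual F.X'') (\<psi> - ?q \<psi>) \<le> nrm (dual F.X'') \<psi> - nrm F.X' (F.restriction \<psi>)"
      using assms(5) by (simp add: field_simps)
    then show ?thesis using q(2) by simp
  qed
  have "ideal_projection F.X'' (range ?J) ?q"
    unfolding ideal_projection_def
  proof (intro conjI ballI allI)
    fix \<psi> assume \<psi>: "\<psi> \<in> vecs (dual F.X'')"
    show "?q \<psi> \<in> vecs (dual F.X'')" by (rule F.canonical_projection_in_dual(1)[OF \<psi>])
    then have "0 \<le> C * nrm (dual F.X'') (\<psi> - ?q \<psi>)"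
      using assms(5) nrm_dual_nonneg[OF F.scaled_nspaces(3) dual_diff[OF \<psi>]] by simp
    then show "nrm (dual F.X'') (?q \<psi>) \<le> nrm (dual F.X'') \<psi>" using ineq[OF \<psi>] by simp
    show "?q (?q \<psi>) = ?q \<psi>"
      unfolding F.canonical_projection_def[of "?q \<psi>"] F.restriction_canonical_projection[OF \<psi>]
      by (simp add: F.canonical_projection_def)
    show "?q (scl (dual F.X'') c \<psi>) = scl (dual F.X'') c (?q \<psi>)" for c
    proof
      fix z
      have "F.restriction (scl (dual F.X'') c \<psi>) = scl F.X' c (F.restriction \<psi>)"
        by (simp add: F.restriction_def scl_dual)
      then show "?q (scl (dual F.X'') c \<psi>) z = scl (dual F.X'') c (?q \<psi>) z"
        using dualD(2)[of z F.X', OF _ F.restriction_in_dual(1)[OF \<psi>]]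
        by (simp add: F.canonical_projection_def scl_dual[of F.X''])
    qed
    fix \<eta> assume \<eta>: "\<eta> \<in> vecs (dual F.X'')"
    show "?q (\<psi> + \<eta>) = ?q \<psi> + ?q \<eta>"
    proof
      fix z
      have "F.restriction (\<psi> + \<eta>) = F.restriction \<psi> + F.restriction \<eta>"
        by (auto simp: F.restriction_def)
      then show "?q (\<psi> + \<eta>) z = (?q \<psi> + ?q \<eta>) z"
        using dualD(1)[of z F.X', OF _ F.restriction_in_dual(1)[OF \<psi>] F.restriction_in_dual(1)[OF \<eta>]]
        by (simp add: F.canonical_projection_def)
    qed
  next
    have "?q \<psi> = 0 \<longleftrightarrow> (\<forall>w\<in>range ?J. \<psi> w = 0)" if \<psi>: "\<psi> \<in> vecs (dual F.X'')" for \<psi>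
    proof
      assume "?q \<psi> = 0"
      then have "F.restriction \<psi> = F.restriction 0"
        using F.restriction_canonical_projection[OF \<psi>] by simp
      then have "\<psi> (?J y) = 0" for y unfolding F.restriction_def by (metis zero_fun_apply)
      then show "\<forall>w\<in>range ?J. \<psi> w = 0" by blast
    next
      assume "\<forall>w\<in>range ?J. \<psi> w = 0"
      then have r: "F.restriction \<psi> = 0" by (auto simp: F.restriction_def)
      have "z 0 = 0" if "z \<in> vecs F.X''" for z
        using dualD(1)[OF that dual_zero dual_zero] by simp
      then show "?q \<psi> = 0" by (auto simp: F.canonical_projection_def r)
    qed
    then show "{\<psi> \<in> vecs (dual F.X''). ?q \<psi> = 0} = annihilator F.X'' (range ?J)"
      unfolding annihilator_def by blast
  qed
  with ineq F.closed_subspace_canonical_embedding show ?thesis unfolding M1_ideal_def by blast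
qed


end
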